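(* Let $K$ be an algebraic function field over a field $k$ and let $V$ be a valuation ring of $K$. Let $\{R_i\mid i\in I\}$ be a directed system of normal local rings such that (a) $V=\bigcup_{i\in I}R_i$; (b) $I$ has a minimum $0$; (c) each $R_i$ is essentially of finite type over $k$ and has quotient field $K$; (d) if $i<j$ then $R_j$ dominates $R_i$. Then the ring $T=\bigcup_{i\in I}\hat R_i$ is Henselian.
   Context: $\hat R$ denotes the completion of a local ring $R$ at its maximal ideal $m_R$. For local rings $R\subset S$, $S$ dominates $R$ if $m_S\cap R=m_R$. For $i<j$ the natural map $\hat R_i\to\hat R_j$ is injective (Zariski's subspace theorem), so $\{\hat R_i\}$ is a directed system with inclusions as transition maps; $T$ is its union (direct limit), a local ring with maximal ideal $m_T=\bigcup_i m_{\hat R_i}$. *)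

theory Defs
  imports
    "HOL-Algebra.QuotRing"
    "HOL-Algebra.Ideal_Product"
    "HOL-Algebra.Polynomials"
    "HOL-Algebra.Generated_Fields"
begin

section \<open>Local rings and Henselian rings\<close>

definition local_ring :: "('a, 'b) ring_scheme \<Rightarrow> bool"
  where "local_ring R \<longleftrightarrow> cring R \<and> (\<exists>!M. maximalideal M R)"

definition max_ideal :: "('a, 'b) ring_scheme \<Rightarrow> 'a set"
  where "max_ideal R = (THE M. maximalideal M R)"

text \<open>Polynomials are coefficient lists with the leading coefficient first.\<close>

definition monic_poly :: "('a, 'b) ring_scheme \<Rightarrow> 'a set \<Rightarrow> 'a list \<Rightarrow> bool"
  where "monic_poly R H p \<longleftrightarrow>
    p \<in> carrier (univ_poly R H) \<and> p \<noteq> [] \<and> lead_coeff p = \<one>\<^bsub>R\<^esub>"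

definition poly_deriv :: "('a, 'b) ring_scheme \<Rightarrow> 'a list \<Rightarrow> 'a list"
  where "poly_deriv R p = ring.normalize R
    (map (\<lambda>i. add_pow R (Suc i) (ring.coeff R p (Suc i))) (rev [0..<degree p]))"

text \<open>A local ring is Henselian if every simple root, in the residue field, of the reduction
  of a monic polynomial lifts to a root in the ring.\<close>

definition henselian :: "('a, 'b) ring_scheme \<Rightarrow> bool"
  where "henselian R \<longleftrightarrow> local_ring R \<and>
    (let M = max_ideal R; F = R Quot M in
      \<forall>p. monic_poly R (carrier R) p \<longrightarrow>
        (let q = map (\<lambda>c. M +>\<^bsub>R\<^esub> c) p in
          \<forall>b \<in> carrier F.
            ring.eval F q b = \<zero>\<^bsub>F\<^esub> \<and> ring.eval F (poly_deriv F q) b \<noteq> \<zero>\<^bsub>F\<^esub> \<longrightarrow>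
            (\<exists>a \<in> carrier R. ring.eval R p a = \<zero>\<^bsub>R\<^esub> \<and> M +>\<^bsub>R\<^esub> a = b)))"


section \<open>Completions\<close>

text \<open>The completion of a local ring \<open>R\<close> with maximal ideal \<open>M\<close> is the inverse limit of the
  rings \<open>R / M\<^sup>n\<close>. A coset of \<open>M\<^sup>n\<close> is the image of a coset of \<open>M\<^sup>m\<close> (with \<open>n \<le> m\<close>) under the
  natural projection iff it contains it.\<close>

definition quot_pow :: "('a, 'b) ring_scheme \<Rightarrow> nat \<Rightarrow> 'a set ring"
  where "quot_pow R n = R Quot (max_ideal R [^]\<^bsub>ideals_set R\<^esub> n)"

definition completion :: "('a, 'b) ring_scheme \<Rightarrow> (nat \<Rightarrow> 'a set) ring"
  where "completion R =
    \<lparr> carrier = {f. (\<forall>n. f n \<in> carrier (quot_pow R n)) \<and> (\<forall>n m. n \<le> m \<longrightarrow> f m \<subseteq> f n)},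
      monoid.mult = (\<lambda>f g n. f n \<otimes>\<^bsub>quot_pow R n\<^esub> g n),
      one = (\<lambda>n. \<one>\<^bsub>quot_pow R n\<^esub>),
      zero = (\<lambda>n. \<zero>\<^bsub>quot_pow R n\<^esub>),
      add = (\<lambda>f g n. f n \<oplus>\<^bsub>quot_pow R n\<^esub> g n) \<rparr>"

text \<open>If \<open>S\<close> dominates its subring \<open>R\<close>, the natural map from the completion of \<open>R\<close> to that of
  \<open>S\<close> sends the coset of \<open>r\<close> modulo the \<open>n\<close>-th power of the maximal ideal of \<open>R\<close> to the coset of
  \<open>r\<close> modulo the \<open>n\<close>-th power of the maximal ideal of \<open>S\<close>. The union below is over equal cosets.\<close>

definition completion_map :: "('a, 'b) ring_scheme \<Rightarrow> (nat \<Rightarrow> 'a set) \<Rightarrow> nat \<Rightarrow> 'a set"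
  where "completion_map S f =
    (\<lambda>n. \<Union>r \<in> f n. (max_ideal S [^]\<^bsub>ideals_set S\<^esub> n) +>\<^bsub>S\<^esub> r)"


section \<open>Direct limits of rings\<close>

text \<open>The direct limit of rings \<open>A i\<close> with transition maps \<open>\<phi> i j\<close> for \<open>i \<le> j\<close> is the
  disjoint union of the \<open>A i\<close> modulo eventual equality; for injective \<open>\<phi> i j\<close> it is the union
  of the \<open>A i\<close> along the identifications \<open>\<phi> i j\<close>. The unions in the ring operations are over
  equal classes.\<close>

definition dirlim_rel ::
  "'i::preorder set \<Rightarrow> ('i \<Rightarrow> ('a, 'b) ring_scheme) \<Rightarrow> ('i \<Rightarrow> 'i \<Rightarrow> 'a \<Rightarrow> 'a) \<Rightarrow> ('i \<times> 'a) rel"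
  where "dirlim_rel I A \<phi> =
    {((i, x), (j, y)). i \<in> I \<and> x \<in> carrier (A i) \<and> j \<in> I \<and> y \<in> carrier (A j) \<and>
       (\<exists>l \<in> I. i \<le> l \<and> j \<le> l \<and> \<phi> i l x = \<phi> j l y)}"

definition dirlim_op ::
  "'i::preorder set \<Rightarrow> ('i \<Rightarrow> ('a, 'b) ring_scheme) \<Rightarrow> ('i \<Rightarrow> 'i \<Rightarrow> 'a \<Rightarrow> 'a) \<Rightarrow>
    ('i \<Rightarrow> 'a \<Rightarrow> 'a \<Rightarrow> 'a) \<Rightarrow> ('i \<times> 'a) set \<Rightarrow> ('i \<times> 'a) set \<Rightarrow> ('i \<times> 'a) set"
  where "dirlim_op I A \<phi> f P Q =
    \<Union> {dirlim_rel I A \<phi> `` {(l, f l (\<phi> i l x) (\<phi> j l y))} |i j l x y.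
        (i, x) \<in> P \<and> (j, y) \<in> Q \<and> l \<in> I \<and> i \<le> l \<and> j \<le> l}"

definition direct_limit ::
  "'i::preorder set \<Rightarrow> ('i \<Rightarrow> ('a, 'b) ring_scheme) \<Rightarrow> ('i \<Rightarrow> 'i \<Rightarrow> 'a \<Rightarrow> 'a) \<Rightarrow> ('i \<times> 'a) set ring"
  where "direct_limit I A \<phi> =
    \<lparr> carrier = (SIGMA i:I. carrier (A i)) // dirlim_rel I A \<phi>,
      monoid.mult = dirlim_op I A \<phi> (\<lambda>l. monoid.mult (A l)),
      one = (\<Union>i \<in> I. dirlim_rel I A \<phi> `` {(i, \<one>\<^bsub>A i\<^esub>)}),
      zero = (\<Union>i \<in> I. dirlim_rel I A \<phi> `` {(i, \<zero>\<^bsub>A i\<^esub>)}),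
      add = dirlim_op I A \<phi> (\<lambda>l. ring.add (A l)) \<rparr>"


section \<open>Subrings of a function field\<close>

text \<open>Throughout, \<open>K\<close> is a field and a subset \<open>R\<close> of its carrier stands for the ring
  \<open>K\<lparr>carrier := R\<rparr>\<close>.\<close>

definition algebraic_function_field :: "('a, 'b) ring_scheme \<Rightarrow> 'a set \<Rightarrow> bool"
  where "algebraic_function_field K k \<longleftrightarrow> field K \<and> subfield k K \<and>
    (\<exists>A. finite A \<and> A \<subseteq> carrier K \<and> generate_field K (k \<union> A) = carrier K)"

definition valuation_ring_of :: "('a, 'b) ring_scheme \<Rightarrow> 'a set \<Rightarrow> bool"
  where "valuation_ring_of K V \<longleftrightarrow> subring V K \<and>
    (\<forall>x \<in> carrier K. x \<noteq> \<zero>\<^bsub>K\<^esub> \<longrightarrow> x \<in> V \<or> inv\<^bsub>K\<^esub> x \<in> V)"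

definition local_subring :: "('a, 'b) ring_scheme \<Rightarrow> 'a set \<Rightarrow> bool"
  where "local_subring K R \<longleftrightarrow> subring R K \<and> local_ring (K\<lparr>carrier := R\<rparr>)"

definition quotient_field_is :: "('a, 'b) ring_scheme \<Rightarrow> 'a set \<Rightarrow> bool"
  where "quotient_field_is K R \<longleftrightarrow>
    carrier K = {a \<otimes>\<^bsub>K\<^esub> inv\<^bsub>K\<^esub> b |a b. a \<in> R \<and> b \<in> R \<and> b \<noteq> \<zero>\<^bsub>K\<^esub>}"

text \<open>For \<open>R\<close> with quotient field \<open>K\<close> this says that \<open>R\<close> is normal.\<close>

definition integrally_closed_in :: "('a, 'b) ring_scheme \<Rightarrow> 'a set \<Rightarrow> bool"
  where "integrally_closed_in K R \<longleftrightarrow>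
    (\<forall>x \<in> carrier K. (\<exists>p. monic_poly K R p \<and> ring.eval K p x = \<zero>\<^bsub>K\<^esub>) \<longrightarrow> x \<in> R)"

text \<open>\<open>R\<close> is a localization, inside \<open>K\<close>, of a finitely generated \<open>k\<close>-algebra \<open>k[A]\<close>.\<close>

definition ess_finite_type :: "('a, 'b) ring_scheme \<Rightarrow> 'a set \<Rightarrow> 'a set \<Rightarrow> bool"
  where "ess_finite_type K k R \<longleftrightarrow>
    (\<exists>A S. finite A \<and> A \<subseteq> carrier K \<and>
       submonoid S K \<and> S \<subseteq> generate_ring K (k \<union> A) \<and> \<zero>\<^bsub>K\<^esub> \<notin> S \<and>
       R = {a \<otimes>\<^bsub>K\<^esub> inv\<^bsub>K\<^esub> s |a s. a \<in> generate_ring K (k \<union> A) \<and> s \<in> S})"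

definition dominates :: "('a, 'b) ring_scheme \<Rightarrow> 'a set \<Rightarrow> 'a set \<Rightarrow> bool"
  where "dominates K S R \<longleftrightarrow> R \<subseteq> S \<and>
    max_ideal (K\<lparr>carrier := S\<rparr>) \<inter> R = max_ideal (K\<lparr>carrier := R\<rparr>)"

end

theory Submission
  imports Defs
begin

text \<open>Each completion \<open>C\<^sub>i\<close> of \<open>R\<^sub>i\<close> satisfies Hensel's lemma, the transition maps
  \<open>C\<^sub>i \<rightarrow> C\<^sub>j\<close> are local homomorphisms because \<open>R\<^sub>j\<close> dominates \<open>R\<^sub>i\<close>, and the Hensel property passes
  to direct limits along local homomorphisms: a polynomial and an approximate root involve finitely
  many elements, so they come from some \<open>C\<^sub>l\<close>, where the root lifts.

  To make the last step simple, locality and the Hensel property are expressed by units instead of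
  maximal ideals and residue fields. The maximal ideal of a local ring is its set of nonunits
  (\<open>max_ideal_eq_nonunits\<close>), and a ring homomorphism is local iff it reflects units. The property
  \<open>simple_roots_lift\<close> of a local ring says that an element \<open>x\<close> at which a monic polynomial takes a
  nonunit value and its derivative a unit value differs by a nonunit from a root; it implies the
  Hensel property (\<open>henselian_if_simple_roots_lift\<close>).

  Hensel's lemma for the completion \<open>C\<close> of a local ring \<open>R\<close> with maximal ideal \<open>M\<close> is Newton's
  iteration for the filtration by the kernels of \<open>C \<rightarrow> R / M\<^sup>n\<close>. These kernels are multiplicative and
  \<open>C\<close> is complete and separated for them since it is an inverse limit. The iteration (\<open>newton\<close>) works
  in any ring with such a filtration. It gives roots, and for linear polynomials it gives inverses, so
  that the units of \<open>C\<close> are the elements whose image in \<open>R / M\<close> is not zero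
  (\<open>completion_unit_iff\<close>). From this it follows that \<open>C\<close> is local and that the transition maps reflect
  units (\<open>completion_map_reflects_units\<close>). The conclusion is \<open>henselian_direct_limit\<close>.\<close>

section \<open>Local rings and their units\<close>

text \<open>Krull's theorem, by Zorn's lemma: the union of a nonempty chain of ideals that avoid \<open>\<one>\<close> is again
  an ideal that avoids \<open>\<one>\<close>.\<close>

lemma (in cring) proper_ideal_in_maximalideal:
  assumes I: "ideal I R" and "\<one> \<notin> I"
  obtains M where "maximalideal M R" "I \<subseteq> M"
proof -
  define \<A> where "\<A> = {J. ideal J R \<and> I \<subseteq> J \<and> \<one> \<notin> J}"
  have "\<Union>C \<in> \<A>" if "C \<noteq> {}" and C: "subset.chain \<A> C" for C
  proof -
    have C\<A>: "C \<subseteq> \<A>" and tot: "\<And>S T. S \<in> C \<Longrightarrow> T \<in> C \<Longrightarrow> S \<subseteq> T \<or> T \<subseteq> S"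
      using C unfolding subset_chain_def by blast+
    from \<open>C \<noteq> {}\<close> obtain S0 where S0: "S0 \<in> C" by blast
    have id: "ideal S R" if "S \<in> C" for S using that C\<A> unfolding \<A>_def by blast
    have "ideal (\<Union>C) R"
    proof (rule idealI)
      show "ring R" by (rule ring_axioms)
      show "subgroup (\<Union>C) (add_monoid R)"
      proof (rule subgroup.intro)
        show "\<Union>C \<subseteq> carrier (add_monoid R)"
          using id ideal.Icarr by fastforce
        show "x \<otimes>\<^bsub>add_monoid R\<^esub> y \<in> \<Union>C" if xy: "x \<in> \<Union>C" "y \<in> \<Union>C" for x y
        proof -
          from xy obtain S T where ST: "S \<in> C" "x \<in> S" "T \<in> C" "y \<in> T" by blast
          then obtain U where U: "U \<in> C" "x \<in> U" "y \<in> U" using tot[of S T] by blast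
          interpret U: ideal U R by (rule id[OF U(1)])
          have "x \<oplus> y \<in> U" using U by simp
          thus ?thesis using U(1) by auto
        qed
        show "\<one>\<^bsub>add_monoid R\<^esub> \<in> \<Union>C"
          using S0 additive_subgroup.zero_closed[OF ideal.axioms(1)[OF id[OF S0]]] by auto
        show "inv\<^bsub>add_monoid R\<^esub> x \<in> \<Union>C" if x: "x \<in> \<Union>C" for x
        proof -
          from x obtain S where S: "S \<in> C" "x \<in> S" by blast
          have "\<ominus> x \<in> S"
            by (rule additive_subgroup.a_inv_closed[OF ideal.axioms(1)[OF id[OF S(1)]] S(2)])
          thus ?thesis using S(1) unfolding a_inv_def by blast
        qed
      qed
      show "x \<otimes> a \<in> \<Union>C" if "a \<in> \<Union>C" "x \<in> carrier R" for a x
        using that id ideal.I_l_closed by fastforce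
      show "a \<otimes> x \<in> \<Union>C" if "a \<in> \<Union>C" "x \<in> carrier R" for a x
        using that id ideal.I_r_closed by fastforce
    qed
    thus ?thesis using C\<A> S0 unfolding \<A>_def by blast
  qed
  moreover have "\<A> \<noteq> {}" using assms unfolding \<A>_def by blast
  ultimately obtain M where M: "M \<in> \<A>" and max: "\<And>S. S \<in> \<A> \<Longrightarrow> M \<subseteq> S \<Longrightarrow> S = M"
    using subset_Zorn_nonempty[of \<A>] by metis
  have "maximalideal M R"
  proof (rule maximalidealI)
    show "ideal M R" using M unfolding \<A>_def by blast
    show "carrier R \<noteq> M" using M unfolding \<A>_def by blast
    fix J assume J: "ideal J R" "M \<subseteq> J" "J \<subseteq> carrier R"
    show "J = M \<or> J = carrier R"
    proof (cases "\<one> \<in> J")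
      case True
      thus ?thesis using ideal.one_imp_carrier[OF J(1)] by blast
    next
      case False
      thus ?thesis using max[of J] J M unfolding \<A>_def by blast
    qed
  qed
  thus ?thesis using that M unfolding \<A>_def by blast
qed

lemma local_ring_maximalideal:
  assumes "local_ring R"
  shows "maximalideal (max_ideal R) R" "maximalideal M R \<Longrightarrow> M = max_ideal R"
  using assms theI'[of "\<lambda>M. maximalideal M R"] unfolding local_ring_def max_ideal_def by blast+

lemma maximalideal_no_units:
  fixes R (structure)
  assumes "cring R" "maximalideal M R"
  shows "M \<inter> Units R = {}"
proof -
  interpret cring R by fact
  interpret maximalideal M R by fact
  have False if "x \<in> M" "x \<in> Units R" for x
  proof -
    have "\<one> \<in> M" using that I_l_closed[of x "inv x"] by simp
    thus False using I_notcarr one_imp_carrier by blast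
  qed
  thus ?thesis by blast
qed

text \<open>A nonunit generates a proper ideal, which lies in some maximal ideal, hence in the only one.
  Membership in the maximal ideal thus becomes a statement about units. That is the form in which it
  can be followed through completions and direct limits, because units are preserved by ring
  homomorphisms.\<close>

lemma max_ideal_eq_nonunits:
  fixes R (structure)
  assumes "local_ring R"
  shows "max_ideal R = carrier R - Units R"
proof
  from assms interpret cring R unfolding local_ring_def by blast
  note max = local_ring_maximalideal[OF assms]
  show "max_ideal R \<subseteq> carrier R - Units R"
    using maximalideal_no_units[OF is_cring max(1)]
      ideal.Icarr[OF maximalideal.axioms(1)[OF max(1)]] by blast
  show "carrier R - Units R \<subseteq> max_ideal R"
  proof
    fix x assume x: "x \<in> carrier R - Units R"
    have "\<one> \<notin> PIdl x"
      using x m_comm unfolding cgenideal_def Units_def by force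
    then obtain M where "maximalideal M R" "PIdl x \<subseteq> M"
      using proper_ideal_in_maximalideal cgenideal_ideal x by blast
    thus "x \<in> max_ideal R" using max(2) cgenideal_self x by blast
  qed
qed

lemma (in cring) unit_factor:
  assumes "x \<in> carrier R" "y \<in> carrier R" "x \<otimes> y \<in> Units R"
  shows "x \<in> Units R"
proof -
  let ?z = "y \<otimes> inv (x \<otimes> y)"
  have z: "?z \<in> carrier R" using assms by simp
  have "x \<otimes> ?z = \<one>" "?z \<otimes> x = \<one>"
    using assms m_comm[OF assms(1) z] by (simp_all add: m_assoc[symmetric])
  thus ?thesis using assms z unfolding Units_def by blast
qed

text \<open>Nonunits absorb multiplication in every commutative ring. If they are also closed under addition,
  they form an ideal, and every proper ideal lies in it since it contains no unit.\<close>

lemma (in cring) local_ringI: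
  assumes "\<one> \<noteq> \<zero>"
    and add: "\<And>x y. x \<in> carrier R - Units R \<Longrightarrow> y \<in> carrier R - Units R \<Longrightarrow> x \<oplus> y \<notin> Units R"
  shows "local_ring R"
proof -
  let ?N = "carrier R - Units R"
  have mult: "x \<otimes> y \<notin> Units R" if "x \<in> ?N" "y \<in> carrier R" for x y
    using that unit_factor by blast
  have N: "ideal ?N R"
  proof (rule idealI)
    show "ring R" by (rule ring_axioms)
    show "subgroup ?N (add_monoid R)"
    proof (rule subgroup.intro)
      show "\<one>\<^bsub>add_monoid R\<^esub> \<in> ?N" using assms(1) unfolding Units_def by auto
      show "inv\<^bsub>add_monoid R\<^esub> x \<in> ?N" if x: "x \<in> ?N" for x
      proof -
        have "\<ominus> x \<notin> Units R" using mult[OF x, of "\<ominus> \<one>"] x by (simp add: r_minus)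
        thus ?thesis using x unfolding a_inv_def[symmetric] by auto
      qed
    qed (use add in auto)
    show "x \<otimes> a \<in> ?N" if "a \<in> ?N" "x \<in> carrier R" for a x
      using mult[OF that] that by (auto simp: m_comm)
    show "a \<otimes> x \<in> ?N" if "a \<in> ?N" "x \<in> carrier R" for a x
      using mult[OF that] that by auto
  qed
  have proper: "J \<subseteq> ?N" if J: "ideal J R" "J \<noteq> carrier R" for J
  proof
    fix x assume x: "x \<in> J"
    interpret J: ideal J R by fact
    have "\<one> \<notin> J" using J J.one_imp_carrier by blast
    hence "x \<notin> Units R" using x J.I_l_closed[OF x, of "inv x"] by auto
    thus "x \<in> ?N" using x by auto
  qed
  have "maximalideal ?N R"
    using N proper by (intro maximalidealI) (use Units_one_closed in blast)+
  moreover have "M = ?N" if M: "maximalideal M R" for M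
  proof -
    interpret M: maximalideal M R by fact
    have "M \<subseteq> ?N" using proper[OF M.is_ideal] M.I_notcarr by blast
    thus ?thesis using M.I_maximal[OF N] Units_one_closed by blast
  qed
  ultimately show ?thesis unfolding local_ring_def using is_cring by blast
qed

section \<open>Derivatives of polynomials\<close>

lemma (in ring) eval_poly_deriv_Nil [simp]: "eval (poly_deriv R []) x = \<zero>"
  by (simp add: poly_deriv_def)

lemma (in ring) poly_deriv_in_carrier:
  "set p \<subseteq> carrier R \<Longrightarrow> set (poly_deriv R p) \<subseteq> carrier R"
  unfolding poly_deriv_def by (intro normalize_in_carrier) (auto simp: image_subset_iff)

text \<open>The list \<open>poly_deriv R p\<close> is normalized, so it is shorter than expected when an integer multiple
  of a coefficient vanishes. Evaluation does not see this, and therefore the recursion is stated for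
  values. For \<open>p = []\<close> the exponent truncates to \<open>0\<close>, which is harmless because the coefficient is then the
  \<open>0\<close>-fold multiple of \<open>a\<close>.\<close>

lemma (in ring) eval_poly_deriv_Cons:
  assumes a: "a \<in> carrier R" and p: "set p \<subseteq> carrier R" and x: "x \<in> carrier R"
  shows "eval (poly_deriv R (a # p)) x
    = ([length p] \<cdot> a) \<otimes> x [^] (length p - 1) \<oplus> eval (poly_deriv R p) x"
proof -
  let ?D = "\<lambda>p. map (\<lambda>i. [Suc i] \<cdot> coeff p (Suc i)) (rev [0..<degree p])"
  have D: "set (?D q) \<subseteq> carrier R" if "set q \<subseteq> carrier R" for q
    using that by (auto simp: image_subset_iff)
  have ev: "eval (poly_deriv R q) x = eval (?D q) x" if "set q \<subseteq> carrier R" for q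
    unfolding poly_deriv_def by (rule eval_normalize[OF D[OF that] x])
  show ?thesis
  proof (cases p)
    case Nil
    thus ?thesis using a x ev[of "[a]"] by simp
  next
    case (Cons b q)
    have "map (\<lambda>i. [Suc i] \<cdot> coeff (a # p) (Suc i)) (rev [0..<length q])
        = map (\<lambda>i. [Suc i] \<cdot> coeff p (Suc i)) (rev [0..<length q])"
      by (rule map_cong) (auto simp: Cons)
    moreover have "coeff (a # p) (length p) = a" by simp
    ultimately have D_Cons: "?D (a # p) = ([length p] \<cdot> a) # ?D p"
      by (simp add: Cons del: coeff.simps add.nat_pow_Suc)
    have "eval (?D (a # p)) x = ([length p] \<cdot> a) \<otimes> x [^] (length p - 1) \<oplus> eval (?D p) x"
      unfolding D_Cons by (simp add: Cons del: coeff.simps add.nat_pow_Suc)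
    thus ?thesis using ev[of "a # p"] ev[OF p] a p by simp
  qed
qed

lemma (in cring) power_taylor:
  fixes n :: nat
  assumes "x \<in> carrier R" "h \<in> carrier R"
  shows "\<exists>q \<in> carrier R. (x \<oplus> h) [^] n
    = x [^] n \<oplus> ([n] \<cdot> (x [^] (n - 1))) \<otimes> h \<oplus> h \<otimes> h \<otimes> q"
proof (induction n)
  case 0
  show ?case using assms by (intro bexI[of _ \<zero>]) auto
next
  case (Suc n)
  then obtain q where q: "q \<in> carrier R"
    and IH: "(x \<oplus> h) [^] n = x [^] n \<oplus> ([n] \<cdot> (x [^] (n - 1))) \<otimes> h \<oplus> h \<otimes> h \<otimes> q"
    by blast
  define d where "d = [n] \<cdot> (x [^] (n - 1))"
  have d: "d \<in> carrier R" unfolding d_def using assms by simp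
  have dx: "d \<otimes> x = [n] \<cdot> (x [^] n)"
    unfolding d_def using assms by (cases n) (auto simp: add_pow_ldistr simp del: add.nat_pow_Suc)
  have S: "[Suc n] \<cdot> (x [^] n) = d \<otimes> x \<oplus> x [^] n"
    using assms by (simp add: dx)
  have xn: "x [^] n \<in> carrier R" using assms by simp
  have "(x \<oplus> h) [^] Suc n = (x [^] n \<oplus> d \<otimes> h \<oplus> h \<otimes> h \<otimes> q) \<otimes> (x \<oplus> h)"
    using assms IH unfolding d_def by simp
  also have "\<dots> = x [^] n \<otimes> x \<oplus> (d \<otimes> x \<oplus> x [^] n) \<otimes> h \<oplus> h \<otimes> h \<otimes> (d \<oplus> q \<otimes> (x \<oplus> h))"
    using assms d q xn by algebra
  finally have "(x \<oplus> h) [^] Suc n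
      = x [^] Suc n \<oplus> ([Suc n] \<cdot> (x [^] n)) \<otimes> h \<oplus> h \<otimes> h \<otimes> (d \<oplus> q \<otimes> (x \<oplus> h))"
    unfolding S by simp
  thus ?case using assms d q by (intro bexI[of _ "d \<oplus> q \<otimes> (x \<oplus> h)"]) auto
qed

text \<open>The first-order Taylor expansion with a remainder divisible by \<open>h\<^sup>2\<close>. This divisibility is what
  makes Newton's iteration converge. It holds for each power of \<open>x\<close> by the previous lemma and is
  preserved by linear combinations.\<close>

lemma (in cring) eval_taylor:
  assumes "set p \<subseteq> carrier R" "x \<in> carrier R" "h \<in> carrier R"
  shows "\<exists>q \<in> carrier R. eval p (x \<oplus> h)
    = eval p x \<oplus> eval (poly_deriv R p) x \<otimes> h \<oplus> h \<otimes> h \<otimes> q"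
  using assms(1)
proof (induction p)
  case Nil
  show ?case using assms(2,3) by (intro bexI[of _ \<zero>]) auto
next
  case (Cons a p)
  let ?n = "length p"
  from Cons obtain q where q: "q \<in> carrier R" and a: "a \<in> carrier R" and p: "set p \<subseteq> carrier R"
    and IH: "eval p (x \<oplus> h) = eval p x \<oplus> eval (poly_deriv R p) x \<otimes> h \<oplus> h \<otimes> h \<otimes> q"
    by auto
  from power_taylor[OF assms(2,3), of ?n] obtain r where r: "r \<in> carrier R"
    and pow: "(x \<oplus> h) [^] ?n
      = x [^] ?n \<oplus> ([?n] \<cdot> (x [^] (?n - 1))) \<otimes> h \<oplus> h \<otimes> h \<otimes> r" by blast
  define d where "d = [?n] \<cdot> (x [^] (?n - 1))"
  define e where "e = eval (poly_deriv R p) x"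
  have carr: "d \<in> carrier R" "e \<in> carrier R" "x [^] ?n \<in> carrier R" "eval p x \<in> carrier R"
    unfolding d_def e_def using assms(2) p
    by (auto intro: eval_in_carrier poly_deriv_in_carrier[THEN eval_in_carrier])
  have ad: "([?n] \<cdot> a) \<otimes> x [^] (?n - 1) = a \<otimes> d"
    unfolding d_def using a assms(2) by (simp add: add_pow_ldistr add_pow_rdistr)
  have "eval (a # p) (x \<oplus> h)
      = a \<otimes> (x [^] ?n \<oplus> d \<otimes> h \<oplus> h \<otimes> h \<otimes> r) \<oplus> (eval p x \<oplus> e \<otimes> h \<oplus> h \<otimes> h \<otimes> q)"
    using IH pow unfolding d_def e_def by simp
  also have "\<dots> = (a \<otimes> x [^] ?n \<oplus> eval p x) \<oplus> (a \<otimes> d \<oplus> e) \<otimes> h \<oplus> h \<otimes> h \<otimes> (a \<otimes> r \<oplus> q)"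
    using a q r carr assms(3) by algebra
  finally show ?case
    using a q r eval_poly_deriv_Cons[OF a p assms(2)] unfolding ad e_def
    by (intro bexI[of _ "a \<otimes> r \<oplus> q"]) auto
qed

lemma (in ring_hom_ring) hom_add_pow:
  fixes n :: nat
  shows "x \<in> carrier R \<Longrightarrow> h ([n] \<cdot>\<^bsub>R\<^esub> x) = [n] \<cdot>\<^bsub>S\<^esub> (h x)"
  by (induct n) auto

text \<open>A homomorphism may kill leading coefficients of the derivative, so it commutes with \<^const>\<open>poly_deriv\<close>
  only after evaluation.\<close>

lemma (in ring_hom_ring) hom_eval_poly_deriv:
  assumes "set p \<subseteq> carrier R" "x \<in> carrier R"
  shows "h (R.eval (poly_deriv R p) x) = S.eval (poly_deriv S (map h p)) (h x)"
  using assms(1)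
proof (induction p)
  case (Cons a p)
  hence "set (map h p) \<subseteq> carrier S" by auto
  with Cons assms(2) show ?case
    by (simp add: R.eval_poly_deriv_Cons S.eval_poly_deriv_Cons hom_add_pow hom_nat_pow
        R.eval_in_carrier R.poly_deriv_in_carrier)
qed simp

section \<open>Lifting simple roots\<close>

text \<open>The Hensel property expressed by units of \<open>R\<close> itself: in a local ring, \<open>x\<close> reduces to a root of
  the reduction of \<open>p\<close> iff \<open>p(x)\<close> is not a unit, and this root is simple iff \<open>p'(x)\<close> is a unit. No
  residue field occurs, so the property can be moved along homomorphisms that preserve and reflect
  units.\<close>

definition simple_roots_lift :: "('a, 'b) ring_scheme \<Rightarrow> bool"
  where "simple_roots_lift R \<longleftrightarrow>
    (\<forall>p x. set p \<subseteq> carrier R \<and> p \<noteq> [] \<and> lead_coeff p = \<one>\<^bsub>R\<^esub> \<and> x \<in> carrier R \<and>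
      ring.eval R p x \<notin> Units R \<and> ring.eval R (poly_deriv R p) x \<in> Units R \<longrightarrow>
      (\<exists>a \<in> carrier R. ring.eval R p a = \<zero>\<^bsub>R\<^esub> \<and> a \<ominus>\<^bsub>R\<^esub> x \<notin> Units R))"

lemma henselian_if_simple_roots_lift:
  fixes R (structure)
  assumes local: "local_ring R" and lift: "simple_roots_lift R"
  shows "henselian R"
proof -
  from local interpret cring R unfolding local_ring_def by blast
  define M where "M = max_ideal R"
  have M_nonunits: "M = carrier R - Units R"
    unfolding M_def by (rule max_ideal_eq_nonunits[OF local])
  interpret M: maximalideal M R
    unfolding M_def by (rule local_ring_maximalideal(1)[OF local])
  interpret h: ring_hom_ring R "R Quot M" "(+>) M" by (rule M.rcos_ring_hom_ring)
  have zero_iff: "M +> y = \<zero>\<^bsub>R Quot M\<^esub> \<longleftrightarrow> y \<in> M" if "y \<in> carrier R" for y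
    using that M.rcos_const_imp_mem M.a_rcos_const unfolding FactRing_def by auto
  have "\<exists>a \<in> carrier R. eval p a = \<zero> \<and> M +> a = b"
    if p: "monic_poly R (carrier R) p" and b: "b \<in> carrier (R Quot M)"
      and root: "ring.eval (R Quot M) (map ((+>) M) p) b = \<zero>\<^bsub>R Quot M\<^esub>"
      and simple: "ring.eval (R Quot M) (poly_deriv (R Quot M) (map ((+>) M) p)) b \<noteq> \<zero>\<^bsub>R Quot M\<^esub>"
    for p b
  proof -
    have pR: "set p \<subseteq> carrier R" and p1: "p \<noteq> []" "lead_coeff p = \<one>"
      using p polynomial_incl unfolding monic_poly_def univ_poly_carrier[symmetric] by blast+
    from b obtain x where x: "x \<in> carrier R" "b = M +> x"
      unfolding FactRing_simps by auto
    have D: "eval (poly_deriv R p) x \<in> carrier R"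
      by (rule eval_in_carrier[OF poly_deriv_in_carrier[OF pR] x(1)])
    have "eval p x \<in> M"
      using root h.eval_hom'[OF x(1) pR] zero_iff eval_in_carrier[OF pR x(1)] x(2) by simp
    moreover have "eval (poly_deriv R p) x \<notin> M"
      using simple h.hom_eval_poly_deriv[OF pR x(1)] zero_iff[OF D] x(2) by simp
    ultimately obtain a where a: "a \<in> carrier R" "eval p a = \<zero>" "a \<ominus> x \<notin> Units R"
      using lift pR p1 x(1) D unfolding simple_roots_lift_def M_nonunits by blast
    have "a \<ominus> x \<in> M" using a x(1) unfolding M_nonunits by simp
    hence "M +> a = b"
      using a(1) x quotient_eq_iff_same_a_r_cos[OF M.is_ideal a(1) x(1)] by simp
    thus ?thesis using a by blast
  qed
  thus ?thesis using local unfolding henselian_def Let_def M_def by blast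
qed

section \<open>Newton iteration in a complete filtered ring\<close>

text \<open>A ring that is separated and complete for a decreasing, multiplicative filtration by ideals. Limits
  are only demanded of sequences whose \<open>n\<close>-th step lies in \<open>J n\<close>; their limit agrees with the \<open>n\<close>-th
  term modulo \<open>J n\<close>.\<close>

locale complete_filtered_ring = cring R for R (structure) +
  fixes J :: "nat \<Rightarrow> 'a set"
  assumes ideal_J: "ideal (J n) R"
    and J_mult: "a \<in> J m \<Longrightarrow> b \<in> J n \<Longrightarrow> a \<otimes> b \<in> J (m + n)"
    and J_antimono: "m \<le> n \<Longrightarrow> J n \<subseteq> J m"
    and separated: "x \<in> carrier R \<Longrightarrow> (\<And>n. x \<in> J n) \<Longrightarrow> x = \<zero>"
    and complete: "(\<And>n. s n \<in> carrier R) \<Longrightarrow> (\<And>n. s (Suc n) \<ominus> s n \<in> J n)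
      \<Longrightarrow> \<exists>x \<in> carrier R. \<forall>n. x \<ominus> s n \<in> J n"
begin

lemma eval_cong_mod_J:
  assumes p: "set p \<subseteq> carrier R" and xy: "x \<in> carrier R" "y \<in> carrier R" "x \<ominus> y \<in> J n"
  shows "eval p x \<ominus> eval p y \<in> J n"
proof -
  interpret J: ideal "J n" R by (rule ideal_J)
  interpret h: ring_hom_ring R "R Quot J n" "(+>) (J n)" by (rule J.rcos_ring_hom_ring)
  have "J n +> x = J n +> y"
    using quotient_eq_iff_same_a_r_cos[OF ideal_J xy(1,2)] xy(3) by simp
  hence "J n +> eval p x = J n +> eval p y"
    using h.eval_hom'[OF xy(1) p] h.eval_hom'[OF xy(2) p] by simp
  thus ?thesis
    using quotient_eq_iff_same_a_r_cos[OF ideal_J, of "eval p x" "eval p y"] p xy eval_in_carrier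
    by simp
qed

text \<open>With \<open>e = p(x)\<close> and \<open>d = p'(x)\<close>, Taylor's formula at \<open>x - e u\<close> gives
  \<open>p(x - e u) = - e (d u - 1) + e\<^sup>2 u\<^sup>2 q\<close>. The first term gains one step in the filtration because
  \<open>d u - 1\<close> lies in \<open>J 1\<close>, the second because it is quadratic in \<open>e\<close>.\<close>

lemma newton_step:
  assumes p: "set p \<subseteq> carrier R"
    and x: "x \<in> carrier R" "eval p x \<in> J (Suc n)"
    and u: "u \<in> carrier R" "eval (poly_deriv R p) x \<otimes> u \<ominus> \<one> \<in> J 1"
  shows "eval p (x \<ominus> eval p x \<otimes> u) \<in> J (Suc (Suc n))"
proof -
  interpret J: ideal "J (Suc (Suc n))" R by (rule ideal_J)
  define e where "e = eval p x"
  define d where "d = eval (poly_deriv R p) x"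
  have carr: "e \<in> carrier R" "d \<in> carrier R"
    unfolding e_def d_def using p x(1)
    by (auto intro: eval_in_carrier poly_deriv_in_carrier[THEN eval_in_carrier])
  define y where "y = \<ominus> (e \<otimes> u)"
  have y: "y \<in> carrier R" unfolding y_def using carr u by simp
  obtain q where q: "q \<in> carrier R" "eval p (x \<oplus> y) = e \<oplus> d \<otimes> y \<oplus> y \<otimes> y \<otimes> q"
    using eval_taylor[OF p x(1) y] unfolding e_def d_def by blast
  have "e \<otimes> (d \<otimes> u \<ominus> \<one>) \<in> J (Suc n + 1)"
    using x(2) u(2) unfolding e_def d_def by (rule J_mult)
  hence 1: "\<ominus> (e \<otimes> (d \<otimes> u \<ominus> \<one>)) \<in> J (Suc (Suc n))" by simp
  have "e \<otimes> e \<in> J (Suc n + Suc n)" using x(2) unfolding e_def by (intro J_mult)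
  hence "e \<otimes> e \<in> J (Suc (Suc n))" using J_antimono[of "Suc (Suc n)" "Suc n + Suc n"] by auto
  hence 2: "(e \<otimes> e) \<otimes> (u \<otimes> u \<otimes> q) \<in> J (Suc (Suc n))" using u(1) q(1) by (simp add: J.I_r_closed)
  have "x \<ominus> e \<otimes> u = x \<oplus> y" unfolding y_def by (simp add: a_minus_def)
  hence "eval p (x \<ominus> e \<otimes> u) = e \<oplus> d \<otimes> y \<oplus> y \<otimes> y \<otimes> q" using q(2) by simp
  also have "\<dots> = \<ominus> (e \<otimes> (d \<otimes> u \<ominus> \<one>)) \<oplus> (e \<otimes> e) \<otimes> (u \<otimes> u \<otimes> q)"
    unfolding y_def using carr u(1) q(1) by algebra
  finally show ?thesis using 1 2 unfolding e_def by simp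
qed

text \<open>Newton's iteration with a fixed approximate inverse \<open>u\<close> of \<open>p'(x)\<close>. All iterates agree with \<open>x\<close>
  modulo \<open>J 1\<close>, so \<open>u\<close> inverts the derivative modulo \<open>J 1\<close> at each of them, and convergence is linear,
  which suffices. The polynomial is arbitrary, not only monic, so that linear polynomials can be used
  to invert elements.\<close>

theorem newton:
  assumes p: "set p \<subseteq> carrier R"
    and x: "x \<in> carrier R" "eval p x \<in> J 1"
    and u: "u \<in> carrier R" "eval (poly_deriv R p) x \<otimes> u \<ominus> \<one> \<in> J 1"
  obtains a where "a \<in> carrier R" "eval p a = \<zero>" "a \<ominus> x \<in> J 1"
proof -
  interpret J1: ideal "J 1" R by (rule ideal_J)
  define s where "s = rec_nat x (\<lambda>_ y. y \<ominus> eval p y \<otimes> u)"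
  have s0: "s 0 = x" and s_Suc: "s (Suc n) = s n \<ominus> eval p (s n) \<otimes> u" for n
    unfolding s_def by simp_all
  note D = poly_deriv_in_carrier[OF p]
  have inv: "s n \<in> carrier R \<and> s n \<ominus> x \<in> J 1 \<and> eval p (s n) \<in> J (Suc n)" for n
  proof (induction n)
    case 0
    show ?case using x s0 J1.zero_closed by (simp add: r_neg a_minus_def)
  next
    case (Suc n)
    hence sn: "s n \<in> carrier R" "s n \<ominus> x \<in> J 1" "eval p (s n) \<in> J (Suc n)" by blast+
    have carr: "eval p (s n) \<in> carrier R" "eval (poly_deriv R p) (s n) \<in> carrier R"
      "eval (poly_deriv R p) x \<in> carrier R"
      using eval_in_carrier p D sn(1) x(1) by auto
    have "(eval (poly_deriv R p) (s n) \<ominus> eval (poly_deriv R p) x) \<otimes> u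
        \<oplus> (eval (poly_deriv R p) x \<otimes> u \<ominus> \<one>) \<in> J 1"
      using eval_cong_mod_J[OF D sn(1) x(1) sn(2)] u by (intro J1.a_closed J1.I_r_closed) auto
    also have "(eval (poly_deriv R p) (s n) \<ominus> eval (poly_deriv R p) x) \<otimes> u
        \<oplus> (eval (poly_deriv R p) x \<otimes> u \<ominus> \<one>) = eval (poly_deriv R p) (s n) \<otimes> u \<ominus> \<one>"
      using carr u(1) by algebra
    finally have "eval p (s (Suc n)) \<in> J (Suc (Suc n))"
      unfolding s_Suc using newton_step[OF p sn(1,3) u(1)] by blast
    moreover have "s (Suc n) \<ominus> x \<in> J 1"
    proof -
      have "eval p (s n) \<in> J 1" using sn(3) J_antimono[of 1 "Suc n"] by auto
      hence "(s n \<ominus> x) \<oplus> eval p (s n) \<otimes> (\<ominus> u) \<in> J 1"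
        using sn(2) u(1) by (intro J1.a_closed J1.I_r_closed) auto
      also have "(s n \<ominus> x) \<oplus> eval p (s n) \<otimes> (\<ominus> u) = s (Suc n) \<ominus> x"
        unfolding s_Suc using carr sn(1) x(1) u(1) by algebra
      finally show ?thesis .
    qed
    ultimately show ?case using sn(1) carr u(1) unfolding s_Suc by simp
  qed
  hence s: "s n \<in> carrier R" and s_x: "s n \<ominus> x \<in> J 1" and ps: "eval p (s n) \<in> J (Suc n)" for n
    by blast+
  have ps': "eval p (s n) \<in> J n" for n using ps[of n] J_antimono[of n "Suc n"] by auto
  have "s (Suc n) \<ominus> s n \<in> J n" for n
  proof -
    interpret Jn: ideal "J n" R by (rule ideal_J)
    have "eval p (s n) \<otimes> (\<ominus> u) \<in> J n" using ps' u(1) by (intro Jn.I_r_closed) auto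
    also have "eval p (s n) \<otimes> (\<ominus> u) = s (Suc n) \<ominus> s n"
      unfolding s_Suc using eval_in_carrier[OF p s[of n]] s[of n] u(1) by algebra
    finally show ?thesis .
  qed
  then obtain a where a: "a \<in> carrier R" "\<And>n. a \<ominus> s n \<in> J n"
    using complete[of s] s by blast
  \<comment> \<open>The limit is congruent to the \<open>n\<close>-th iterate modulo \<open>J n\<close>, hence so are the values of \<open>p\<close>.\<close>
  have "eval p a \<in> J n" for n
  proof -
    interpret Jn: ideal "J n" R by (rule ideal_J)
    have "(eval p a \<ominus> eval p (s n)) \<oplus> eval p (s n) \<in> J n"
      using eval_cong_mod_J[OF p a(1) s a(2)] ps' by (rule Jn.a_closed)
    also have "(eval p a \<ominus> eval p (s n)) \<oplus> eval p (s n) = eval p a"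
      using eval_in_carrier[OF p a(1)] eval_in_carrier[OF p s] by algebra
    finally show ?thesis .
  qed
  hence "eval p a = \<zero>" using separated eval_in_carrier[OF p a(1)] by blast
  moreover have "a \<ominus> x \<in> J 1"
  proof -
    have "(a \<ominus> s 1) \<oplus> (s 1 \<ominus> x) \<in> J 1" using a(2) s_x by (rule J1.a_closed)
    also have "(a \<ominus> s 1) \<oplus> (s 1 \<ominus> x) = a \<ominus> x" using a(1) s[of 1] x(1) by algebra
    finally show ?thesis .
  qed
  ultimately show ?thesis using that a(1) by blast
qed

text \<open>An inverse of \<open>x\<close> is a root of \<open>x X - 1\<close>, and \<open>u\<close> is an approximate root. Newton's iteration
  takes the place of the geometric series.\<close>

lemma unit_if_unit_mod_J1:
  assumes x: "x \<in> carrier R" and u: "u \<in> carrier R" "x \<otimes> u \<ominus> \<one> \<in> J 1"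
  shows "x \<in> Units R"
proof -
  let ?p = "[x, \<ominus> \<one>]"
  have p: "set ?p \<subseteq> carrier R" using x by simp
  have ev: "eval ?p y = x \<otimes> y \<ominus> \<one>" if "y \<in> carrier R" for y
    using that x by (simp add: a_minus_def)
  have "eval (poly_deriv R ?p) u = x"
    using x u(1) by (simp add: eval_poly_deriv_Cons)
  then obtain a where a: "a \<in> carrier R" "eval ?p a = \<zero>"
    using newton[OF p u(1) _ u(1)] u ev[OF u(1)] by metis
  have "x \<otimes> a \<ominus> \<one> = \<zero>" using a ev[OF a(1)] by simp
  hence "x \<otimes> a = \<one>" using a(1) x r_right_minus_eq[of "x \<otimes> a" \<one>] by simp
  thus ?thesis using a(1) x unit_factor[of x a] by simp
qed

end

section \<open>The completion of a local ring\<close>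

locale local_cring = cring R for R (structure) +
  assumes local: "local_ring R"
begin

abbreviation "C \<equiv> completion R"

definition M_pow :: "nat \<Rightarrow> 'a set"
  where "M_pow n = max_ideal R [^]\<^bsub>ideals_set R\<^esub> n"

text \<open>Elements of the completion are handled through sequences of representatives in \<open>R\<close>: the coherent
  sequences are those whose cosets form a point of the inverse limit.\<close>

definition coherent :: "(nat \<Rightarrow> 'a) \<Rightarrow> bool"
  where "coherent r \<longleftrightarrow> (\<forall>n. r n \<in> carrier R) \<and> (\<forall>n m. n \<le> m \<longrightarrow> r m \<ominus> r n \<in> M_pow n)"

definition cosets :: "(nat \<Rightarrow> 'a) \<Rightarrow> nat \<Rightarrow> 'a set"
  where "cosets r n = M_pow n +> r n"

lemma maximalideal_max_ideal: "maximalideal (max_ideal R) R"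
  by (rule local_ring_maximalideal(1)[OF local])

lemma M_pow_Suc: "M_pow (Suc n) = M_pow n \<cdot> max_ideal R"
  unfolding M_pow_def by (simp add: ideals_set_def)

lemma M_pow_0: "M_pow 0 = carrier R"
  unfolding M_pow_def by (simp add: ideals_set_def)

lemma ideal_max: "ideal (max_ideal R) R"
  using maximalideal_max_ideal by (rule maximalideal.axioms)

lemma ideal_M_pow: "ideal (M_pow n) R"
  by (induction n) (simp_all add: M_pow_0 M_pow_Suc oneideal ideal_prod_is_ideal ideal_max)

lemma M_pow_1: "M_pow 1 = max_ideal R"
  using M_pow_Suc[of 0] ideal_prod_one[OF ideal_max] ideal_prod_commute[OF oneideal ideal_max]
  by (simp add: M_pow_0)

lemma M_pow_antimono: "m \<le> n \<Longrightarrow> M_pow n \<subseteq> M_pow m"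
proof (induction n rule: dec_induct)
  case (step n)
  thus ?case using ideal_prod_inter[OF ideal_M_pow[of n] ideal_max] unfolding M_pow_Suc by blast
qed simp

lemma M_pow_mult:
  assumes "a \<in> M_pow m" "b \<in> M_pow n"
  shows "a \<otimes> b \<in> M_pow (m + n)"
proof -
  interpret S: comm_monoid "ideals_set R" by (rule ideals_set_is_comm_monoid)
  have "max_ideal R \<in> carrier (ideals_set R)" using ideal_max by (simp add: ideals_set_def)
  hence "M_pow (m + n) = M_pow m \<cdot> M_pow n"
    unfolding M_pow_def using S.nat_pow_mult[of "max_ideal R" m n] by (simp add: ideals_set_def)
  thus ?thesis using assms by (simp add: ideal_prod.prod)
qed

lemma abelian_subgroup_M_pow: "abelian_subgroup (M_pow n) R"
  by (rule abelian_subgroupI3[OF ideal.axioms(1)[OF ideal_M_pow] is_abelian_group])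

lemma coset_eq_iff:
  "x \<in> carrier R \<Longrightarrow> y \<in> carrier R \<Longrightarrow> M_pow n +> x = M_pow n +> y \<longleftrightarrow> x \<ominus> y \<in> M_pow n"
  using quotient_eq_iff_same_a_r_cos[OF ideal_M_pow] by simp

lemma coset_eq_M_pow_iff: "x \<in> carrier R \<Longrightarrow> M_pow n +> x = M_pow n \<longleftrightarrow> x \<in> M_pow n"
  using ideal.rcos_const_imp_mem[OF ideal_M_pow] a_rcos_zero[OF ideal_M_pow] by blast

lemma coherentD: "coherent r \<Longrightarrow> r n \<in> carrier R"
  "coherent r \<Longrightarrow> n \<le> m \<Longrightarrow> r m \<ominus> r n \<in> M_pow n"
  unfolding coherent_def by blast+

lemma coherentI:
  assumes "\<And>n. r n \<in> carrier R" "\<And>n m. n \<le> m \<Longrightarrow> M_pow n +> r m = M_pow n +> r n"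
  shows "coherent r"
  using assms coset_eq_iff unfolding coherent_def by blast

lemma coherent_coset_eq:
  "coherent r \<Longrightarrow> n \<le> m \<Longrightarrow> M_pow n +> r m = M_pow n +> r n"
  using coset_eq_iff coherentD by blast

lemma quot_pow_eq: "quot_pow R n = R Quot M_pow n"
  unfolding quot_pow_def M_pow_def ..

lemma cring_quot_pow: "cring (quot_pow R n)"
  unfolding quot_pow_eq by (rule ideal.quotient_is_cring[OF ideal_M_pow is_cring])

text \<open>For \<open>n \<le> m\<close>, a coset of \<open>M\<^sup>m\<close> is contained in one of \<open>M\<^sup>n\<close> iff their representatives agree
  modulo \<open>M\<^sup>n\<close>, so the inclusions that define the inverse limit are the coherence of representatives.\<close>

lemma carrier_completion: "carrier C = {cosets r |r. coherent r}"
proof (intro equalityI subsetI)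
  fix f assume f: "f \<in> carrier C"
  hence "\<forall>n. \<exists>r \<in> carrier R. f n = M_pow n +> r"
    unfolding completion_def quot_pow_eq FactRing_simps by auto
  then obtain r where r: "\<And>n. r n \<in> carrier R" "\<And>n. f n = M_pow n +> r n" by metis
  have "coherent r"
  proof (rule coherentI[OF r(1)])
    fix n m :: nat assume "n \<le> m"
    hence "f m \<subseteq> f n" using f unfolding completion_def by simp
    moreover have "r m \<in> f m"
      unfolding r(2) using r(1)
      by (rule abelian_subgroup.a_rcos_self[OF abelian_subgroup_M_pow])
    ultimately have "r m \<in> M_pow n +> r n" using r(2) by blast
    thus "M_pow n +> r m = M_pow n +> r n"
      using abelian_subgroup.a_repr_independence'[OF abelian_subgroup_M_pow _ r(1)] by metis
  qed
  moreover have "f = cosets r" unfolding cosets_def using r(2) by blast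
  ultimately show "f \<in> {cosets r |r. coherent r}" by blast
next
  fix f assume "f \<in> {cosets r |r. coherent r}"
  then obtain r where r: "coherent r" "f = cosets r" by blast
  have "f m \<subseteq> f n" if "n \<le> m" for n m
  proof -
    have "M_pow m +> r m \<subseteq> M_pow n +> r m"
      using M_pow_antimono[OF that] unfolding a_r_coset_def r_coset_def by auto
    thus ?thesis using coherent_coset_eq[OF r(1) that] unfolding r(2) cosets_def by simp
  qed
  moreover have "f n \<in> carrier (quot_pow R n)" for n
    unfolding quot_pow_eq FactRing_simps r(2) cosets_def using coherentD(1)[OF r(1)] by auto
  ultimately show "f \<in> carrier C" unfolding completion_def by simp
qed

lemma component_closed: "f \<in> carrier C \<Longrightarrow> f n \<in> carrier (quot_pow R n)"
  unfolding completion_def by simp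

lemma component_simps:
  "(f \<otimes>\<^bsub>C\<^esub> g) n = f n \<otimes>\<^bsub>quot_pow R n\<^esub> g n"
  "(f \<oplus>\<^bsub>C\<^esub> g) n = f n \<oplus>\<^bsub>quot_pow R n\<^esub> g n"
  "\<one>\<^bsub>C\<^esub> n = \<one>\<^bsub>quot_pow R n\<^esub>" "\<zero>\<^bsub>C\<^esub> n = \<zero>\<^bsub>quot_pow R n\<^esub>"
  unfolding completion_def by simp_all

lemma coset_mult: "x \<in> carrier R \<Longrightarrow> y \<in> carrier R
    \<Longrightarrow> (M_pow n +> x) \<otimes>\<^bsub>quot_pow R n\<^esub> (M_pow n +> y) = M_pow n +> (x \<otimes> y)"
  and coset_add: "x \<in> carrier R \<Longrightarrow> y \<in> carrier R
    \<Longrightarrow> (M_pow n +> x) \<oplus>\<^bsub>quot_pow R n\<^esub> (M_pow n +> y) = M_pow n +> (x \<oplus> y)"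
  and coset_one: "\<one>\<^bsub>quot_pow R n\<^esub> = M_pow n +> \<one>"
  and coset_zero: "\<zero>\<^bsub>quot_pow R n\<^esub> = M_pow n +> \<zero>"
  using ring_hom_mult[OF ideal.rcos_ring_hom[OF ideal_M_pow]]
    ring_hom_add[OF ideal.rcos_ring_hom[OF ideal_M_pow]]
    ring_hom_one[OF ideal.rcos_ring_hom[OF ideal_M_pow]]
    ring_hom_zero[OF ideal.rcos_ring_hom[OF ideal_M_pow] ring_axioms
      ideal.quotient_is_ring[OF ideal_M_pow]]
  by (simp_all add: quot_pow_eq)

lemma coherent_mult:
  assumes r: "coherent r" and s: "coherent s"
  shows "coherent (\<lambda>n. r n \<otimes> s n)" "cosets r \<otimes>\<^bsub>C\<^esub> cosets s = cosets (\<lambda>n. r n \<otimes> s n)"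
proof -
  show "coherent (\<lambda>n. r n \<otimes> s n)"
  proof (rule coherentI)
    fix n m :: nat assume nm: "n \<le> m"
    show "M_pow n +> (r m \<otimes> s m) = M_pow n +> (r n \<otimes> s n)"
      using coherentD(1)[OF r] coherentD(1)[OF s] coherent_coset_eq[OF r nm]
        coherent_coset_eq[OF s nm] by (simp add: coset_mult[symmetric])
  qed (use coherentD(1)[OF r] coherentD(1)[OF s] in simp)
  show "cosets r \<otimes>\<^bsub>C\<^esub> cosets s = cosets (\<lambda>n. r n \<otimes> s n)"
    using coherentD(1)[OF r] coherentD(1)[OF s] by (auto simp: component_simps cosets_def coset_mult)
qed

lemma coherent_add:
  assumes r: "coherent r" and s: "coherent s"
  shows "coherent (\<lambda>n. r n \<oplus> s n)" "cosets r \<oplus>\<^bsub>C\<^esub> cosets s = cosets (\<lambda>n. r n \<oplus> s n)"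
proof -
  show "coherent (\<lambda>n. r n \<oplus> s n)"
  proof (rule coherentI)
    fix n m :: nat assume nm: "n \<le> m"
    show "M_pow n +> (r m \<oplus> s m) = M_pow n +> (r n \<oplus> s n)"
      using coherentD(1)[OF r] coherentD(1)[OF s] coherent_coset_eq[OF r nm]
        coherent_coset_eq[OF s nm] by (simp add: coset_add[symmetric])
  qed (use coherentD(1)[OF r] coherentD(1)[OF s] in simp)
  show "cosets r \<oplus>\<^bsub>C\<^esub> cosets s = cosets (\<lambda>n. r n \<oplus> s n)"
    using coherentD(1)[OF r] coherentD(1)[OF s] by (auto simp: component_simps cosets_def coset_add)
qed

lemma coherent_const: "x \<in> carrier R \<Longrightarrow> coherent (\<lambda>_. x)"
  by (rule coherentI) auto

lemma one_completion: "\<one>\<^bsub>C\<^esub> = cosets (\<lambda>_. \<one>)"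
  and zero_completion: "\<zero>\<^bsub>C\<^esub> = cosets (\<lambda>_. \<zero>)"
  by (auto simp: component_simps cosets_def coset_one coset_zero)

lemma coherent_uminus:
  assumes r: "coherent r"
  shows "coherent (\<lambda>n. \<ominus> r n)" "cosets (\<lambda>n. \<ominus> r n) \<oplus>\<^bsub>C\<^esub> cosets r = \<zero>\<^bsub>C\<^esub>"
proof -
  have "coherent (\<lambda>n. \<ominus> \<one> \<otimes> r n)" by (rule coherent_mult(1)[OF coherent_const r]) simp
  thus c: "coherent (\<lambda>n. \<ominus> r n)" using coherentD(1)[OF r] by (simp add: l_minus)
  show "cosets (\<lambda>n. \<ominus> r n) \<oplus>\<^bsub>C\<^esub> cosets r = \<zero>\<^bsub>C\<^esub>"
    using coherentD(1)[OF r] by (simp add: coherent_add(2)[OF c r] zero_completion l_neg)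
qed

text \<open>The ring operations are taken componentwise, so every axiom is inherited from the rings \<open>R / M\<^sup>n\<close>.
  Closure and the existence of negatives rest on coherent representatives.\<close>

lemma cring_completion: "cring C"
proof (rule cringI)
  show "abelian_group C"
  proof (rule abelian_groupI)
    show "f \<oplus>\<^bsub>C\<^esub> g \<in> carrier C" if "f \<in> carrier C" "g \<in> carrier C" for f g
      using that coherent_add unfolding carrier_completion by blast
    show "\<zero>\<^bsub>C\<^esub> \<in> carrier C"
      using coherent_const[OF zero_closed] unfolding zero_completion carrier_completion by blast
    show "\<exists>g \<in> carrier C. g \<oplus>\<^bsub>C\<^esub> f = \<zero>\<^bsub>C\<^esub>" if "f \<in> carrier C" for f
      using that coherent_uminus unfolding carrier_completion by blast
  qed (rule ext, simp add: component_simps component_closed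
      cring.cring_simprules[OF cring_quot_pow])+
  show "comm_monoid C"
  proof (rule comm_monoidI)
    show "f \<otimes>\<^bsub>C\<^esub> g \<in> carrier C" if "f \<in> carrier C" "g \<in> carrier C" for f g
      using that coherent_mult unfolding carrier_completion by blast
    show "\<one>\<^bsub>C\<^esub> \<in> carrier C"
      using coherent_const[OF one_closed] unfolding one_completion carrier_completion by blast
  qed (rule ext, simp add: component_simps component_closed
      cring.cring_simprules[OF cring_quot_pow]
      monoid.r_one[OF ring.is_monoid[OF cring.axioms(1)[OF cring_quot_pow]]])+
qed (rule ext, simp add: component_simps component_closed
    cring.cring_simprules[OF cring_quot_pow])

lemma component_hom: "ring_hom_cring C (quot_pow R n) (\<lambda>f. f n)"
  by (intro ring_hom_cring.intro ring_hom_cring_axioms.intro cring_completion cring_quot_pow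
      ring_hom_memI) (simp_all add: component_simps component_closed)

text \<open>The kernels of the projections to \<open>R / M\<^sup>n\<close>. They are preferred to the powers of the maximal ideal of the
  completion because completeness for them is a direct property of an inverse limit.\<close>

definition filtration :: "nat \<Rightarrow> (nat \<Rightarrow> 'a set) set"
  where "filtration n = {f \<in> carrier C. f n = \<zero>\<^bsub>quot_pow R n\<^esub>}"

lemma cosets_in_filtration_iff:
  assumes "coherent r"
  shows "cosets r \<in> filtration n \<longleftrightarrow> r n \<in> M_pow n"
  using assms coset_eq_M_pow_iff[OF coherentD(1)[OF assms]] a_rcos_zero[OF ideal_M_pow] 
    additive_subgroup.zero_closed[OF ideal.axioms(1)[OF ideal_M_pow]]
  unfolding filtration_def carrier_completion by (auto simp: cosets_def coset_zero)

lemma minus_in_filtration_iff: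
  assumes "f \<in> carrier C" "g \<in> carrier C"
  shows "f \<ominus>\<^bsub>C\<^esub> g \<in> filtration n \<longleftrightarrow> f n = g n"
proof -
  interpret h: ring_hom_cring C "quot_pow R n" "\<lambda>f. f n" by (rule component_hom)
  have "(f \<ominus>\<^bsub>C\<^esub> g) n = f n \<ominus>\<^bsub>quot_pow R n\<^esub> g n"
    using assms by (simp add: a_minus_def)
  thus ?thesis using assms h.S.r_right_minus_eq unfolding filtration_def by simp
qed

lemma filtration_memD:
  assumes "r n \<in> M_pow n" "coherent r" "n \<le> m"
  shows "r m \<in> M_pow n"
  using assms coset_eq_M_pow_iff coherentD(1)[OF assms(2)] coherent_coset_eq[OF assms(2,3)] by metis

text \<open>The condition on consecutive terms says that \<open>s m\<close> and \<open>s n\<close> have the same component at \<open>n\<close> for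
  all \<open>m \<ge> n\<close>. The limit is therefore the diagonal.\<close>

lemma completion_complete:
  assumes s: "\<And>n. s n \<in> carrier C" "\<And>n. s (Suc n) \<ominus>\<^bsub>C\<^esub> s n \<in> filtration n"
  shows "\<exists>f \<in> carrier C. \<forall>n. f \<ominus>\<^bsub>C\<^esub> s n \<in> filtration n"
proof -
  have sub: "s l m \<subseteq> s l n" if "n \<le> m" for l n m
    using s(1)[of l] that unfolding completion_def by simp
  obtain r where r: "\<And>l. coherent (r l)" "\<And>l. s l = cosets (r l)"
    using s(1) unfolding carrier_completion by simp metis
  have eq: "s m n = s n n" if "n \<le> m" for m n
    using that
  proof (induction m rule: dec_induct)
    case (step m)
    have "s (Suc m) m = s m m" using s minus_in_filtration_iff by blast
    hence "M_pow m +> r (Suc m) m = M_pow m +> r m m" unfolding r(2) cosets_def .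
    hence "r (Suc m) m \<ominus> r m m \<in> M_pow n"
      using coset_eq_iff coherentD(1)[OF r(1)] M_pow_antimono[OF step(1)] by blast
    hence "M_pow n +> r (Suc m) m = M_pow n +> r m m"
      using coset_eq_iff coherentD(1)[OF r(1)] by blast
    hence "s (Suc m) n = s m n"
      using coherent_coset_eq[OF r(1) step(1)] unfolding r(2) cosets_def by simp
    thus ?case using step by simp
  qed simp
  define f where "f = (\<lambda>n. s n n)"
  have "f m \<subseteq> f n" if "n \<le> m" for n m
    using sub[OF that, of m] eq[OF that] unfolding f_def by simp
  hence f: "f \<in> carrier C"
    using component_closed[OF s(1)] unfolding completion_def f_def by simp
  moreover have "f \<ominus>\<^bsub>C\<^esub> s n \<in> filtration n" for n
    using minus_in_filtration_iff[OF f s(1)] unfolding f_def by simp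
  ultimately show ?thesis by blast
qed

sublocale completion: complete_filtered_ring C filtration
proof (intro complete_filtered_ring.intro complete_filtered_ring_axioms.intro)
  show "cring C" by (rule cring_completion)
  show "ideal (filtration n) C" for n
  proof -
    interpret h: ring_hom_cring C "quot_pow R n" "\<lambda>f. f n" by (rule component_hom)
    have "filtration n = a_kernel C (quot_pow R n) (\<lambda>f. f n)"
      unfolding filtration_def a_kernel_def kernel_def by simp
    thus ?thesis using h.ring.kernel_is_ideal by simp
  qed
  show "f \<otimes>\<^bsub>C\<^esub> g \<in> filtration (m + n)" if f: "f \<in> filtration m" and g: "g \<in> filtration n" for f g m n
  proof -
    obtain r s where r: "coherent r" "f = cosets r" and s: "coherent s" "g = cosets s"
      using f g unfolding filtration_def carrier_completion by auto
    \<comment> \<open>Coherence moves both memberships to the common index \<open>m + n\<close>.\<close>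
    have "r m \<in> M_pow m" "s n \<in> M_pow n"
      using f g cosets_in_filtration_iff r s by blast+
    hence "r (m + n) \<otimes> s (m + n) \<in> M_pow (m + n)"
      using filtration_memD[of r m "m + n"] filtration_memD[of s n "m + n"] r s M_pow_mult by simp
    thus ?thesis
      using cosets_in_filtration_iff[OF coherent_mult(1)[OF r(1) s(1)]]
      unfolding r(2) s(2) coherent_mult(2)[OF r(1) s(1)] by simp
  qed
  show "filtration n \<subseteq> filtration m" if "m \<le> n" for m n
  proof
    fix f assume f: "f \<in> filtration n"
    then obtain r where r: "coherent r" "f = cosets r"
      unfolding filtration_def carrier_completion by auto
    have "r n \<in> M_pow m" using f cosets_in_filtration_iff r M_pow_antimono[OF that] by blast
    hence "r m \<in> M_pow m"
      using coset_eq_M_pow_iff coherentD(1)[OF r(1)] coherent_coset_eq[OF r(1) that] by metis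
    thus "f \<in> filtration m" using cosets_in_filtration_iff r by blast
  qed
  show "f = \<zero>\<^bsub>C\<^esub>" if "f \<in> carrier C" "\<And>n. f \<in> filtration n" for f
    using that unfolding filtration_def by (auto simp: component_simps)
  show "\<exists>f \<in> carrier C. \<forall>n. f \<ominus>\<^bsub>C\<^esub> s n \<in> filtration n"
    if "\<And>n. s n \<in> carrier C" "\<And>n. s (Suc n) \<ominus>\<^bsub>C\<^esub> s n \<in> filtration n" for s
    using that by (rule completion_complete)
qed

text \<open>If \<open>r 1\<close> is a unit of \<open>R\<close>, its constant inverse inverts the element modulo the first filtration
  step, which is enough by completeness. Conversely, if \<open>r 1\<close> is not a unit, the element lies in the
  proper ideal \<open>filtration 1\<close>.\<close>

lemma completion_unit_iff:
  assumes r: "coherent r"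
  shows "cosets r \<in> Units C \<longleftrightarrow> r 1 \<in> Units R"
proof
  have C: "cosets r \<in> carrier C" using r unfolding carrier_completion by blast
  assume "r 1 \<in> Units R"
  hence u: "inv r 1 \<in> carrier R" "r 1 \<otimes> inv r 1 = \<one>" by auto
  let ?g = "cosets (\<lambda>_. inv r 1)"
  note g = coherent_const[OF u(1)]
  have gC: "?g \<in> carrier C" using g unfolding carrier_completion by blast
  have "(cosets r \<otimes>\<^bsub>C\<^esub> ?g) 1 = \<one>\<^bsub>C\<^esub> 1"
    unfolding coherent_mult(2)[OF r g] one_completion cosets_def using u(2) by simp
  hence "cosets r \<otimes>\<^bsub>C\<^esub> ?g \<ominus>\<^bsub>C\<^esub> \<one>\<^bsub>C\<^esub> \<in> filtration 1"
    using minus_in_filtration_iff[of "cosets r \<otimes>\<^bsub>C\<^esub> ?g" "\<one>\<^bsub>C\<^esub>" 1] C gC by simp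
  thus "cosets r \<in> Units C" by (rule completion.unit_if_unit_mod_J1[OF C gC])
next
  have C: "cosets r \<in> carrier C" using r unfolding carrier_completion by blast
  assume u: "cosets r \<in> Units C"
  show "r 1 \<in> Units R"
  proof (rule ccontr)
    assume "r 1 \<notin> Units R"
    hence "r 1 \<in> M_pow 1"
      unfolding M_pow_1 max_ideal_eq_nonunits[OF local] using coherentD(1)[OF r] by blast
    hence "cosets r \<in> filtration 1" using cosets_in_filtration_iff[OF r] by simp
    hence "cosets r \<otimes>\<^bsub>C\<^esub> inv\<^bsub>C\<^esub> cosets r \<in> filtration 1"
      by (rule ideal.I_r_closed[OF completion.ideal_J _ completion.Units_inv_closed[OF u]])
    hence "cosets (\<lambda>_. \<one>) \<in> filtration 1" using u by (simp add: one_completion)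
    hence "\<one> \<in> max_ideal R"
      using cosets_in_filtration_iff[OF coherent_const[OF one_closed]] by (simp only: M_pow_1)
    thus False unfolding max_ideal_eq_nonunits[OF local] by simp
  qed
qed

lemma nonunits_eq_filtration_1: "carrier C - Units C = filtration 1"
proof -
  have "f \<notin> Units C \<longleftrightarrow> f \<in> filtration 1" if f: "f \<in> carrier C" for f
  proof -
    obtain r where r: "coherent r" "f = cosets r" using f unfolding carrier_completion by blast
    have "r 1 \<notin> Units R \<longleftrightarrow> r 1 \<in> M_pow 1"
      unfolding M_pow_1 max_ideal_eq_nonunits[OF local] using coherentD(1)[OF r(1)] by blast
    thus ?thesis
      using completion_unit_iff[OF r(1)] cosets_in_filtration_iff[OF r(1)] unfolding r(2) by blast
  qed
  moreover have "filtration 1 \<subseteq> carrier C" unfolding filtration_def by blast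
  ultimately show ?thesis by blast
qed

text \<open>The nonunits form the ideal \<open>filtration 1\<close>, in particular they are closed under addition.\<close>

lemma local_ring_completion: "local_ring C"
proof (rule completion.local_ringI)
  interpret J: ideal "filtration 1" C by (rule completion.ideal_J)
  have "\<zero>\<^bsub>C\<^esub> \<notin> Units C"
    using J.zero_closed unfolding nonunits_eq_filtration_1[symmetric] by blast
  thus "\<one>\<^bsub>C\<^esub> \<noteq> \<zero>\<^bsub>C\<^esub>" using completion.Units_one_closed by metis
  show "f \<oplus>\<^bsub>C\<^esub> g \<notin> Units C" if "f \<in> carrier C - Units C" "g \<in> carrier C - Units C" for f g
    using that J.a_closed[of f g] unfolding nonunits_eq_filtration_1
    unfolding nonunits_eq_filtration_1[symmetric] by blast
qed

text \<open>Hensel's lemma: if \<open>p'(x)\<close> is a unit, its inverse can serve as the multiplier in Newton's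
  iteration.\<close>

lemma simple_roots_lift_completion: "simple_roots_lift C"
proof -
  interpret J: ideal "filtration 1" C by (rule completion.ideal_J)
  have "\<exists>a \<in> carrier C. completion.eval p a = \<zero>\<^bsub>C\<^esub> \<and> a \<ominus>\<^bsub>C\<^esub> x \<notin> Units C"
    if p: "set p \<subseteq> carrier C" and x: "x \<in> carrier C"
      and root: "completion.eval p x \<notin> Units C"
      and simple: "completion.eval (poly_deriv C p) x \<in> Units C" for p x
  proof -
    have "completion.eval p x \<in> filtration 1"
      using root completion.eval_in_carrier[OF p x] unfolding nonunits_eq_filtration_1[symmetric]
      by blast
    moreover have "completion.eval (poly_deriv C p) x
        \<otimes>\<^bsub>C\<^esub> inv\<^bsub>C\<^esub> completion.eval (poly_deriv C p) x \<ominus>\<^bsub>C\<^esub> \<one>\<^bsub>C\<^esub> \<in> filtration 1"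
      unfolding completion.Units_r_inv[OF simple]
        completion.r_right_minus_eq[OF completion.one_closed completion.one_closed,
          THEN iffD2, OF refl]
      by (rule J.zero_closed)
    ultimately obtain a where a: "a \<in> carrier C" "completion.eval p a = \<zero>\<^bsub>C\<^esub>"
        "a \<ominus>\<^bsub>C\<^esub> x \<in> filtration 1"
      using completion.newton[OF p x _ completion.Units_inv_closed[OF simple]] by blast
    thus ?thesis unfolding nonunits_eq_filtration_1[symmetric] by blast
  qed
  thus ?thesis unfolding simple_roots_lift_def by blast
qed

end

section \<open>Direct limits\<close>

locale directed_rings =
  fixes I :: "'i::preorder set" and A :: "'i \<Rightarrow> ('a, 'b) ring_scheme"
    and \<phi> :: "'i \<Rightarrow> 'i \<Rightarrow> 'a \<Rightarrow> 'a"
  assumes nonempty: "I \<noteq> {}"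
    and directed: "i \<in> I \<Longrightarrow> j \<in> I \<Longrightarrow> \<exists>l \<in> I. i \<le> l \<and> j \<le> l"
    and cring_A: "i \<in> I \<Longrightarrow> cring (A i)"
    and \<phi>_hom: "i \<in> I \<Longrightarrow> j \<in> I \<Longrightarrow> i \<le> j \<Longrightarrow> \<phi> i j \<in> ring_hom (A i) (A j)"
    and \<phi>_id: "i \<in> I \<Longrightarrow> x \<in> carrier (A i) \<Longrightarrow> \<phi> i i x = x"
    and \<phi>_comp: "i \<in> I \<Longrightarrow> j \<in> I \<Longrightarrow> l \<in> I \<Longrightarrow> i \<le> j \<Longrightarrow> j \<le> l \<Longrightarrow> x \<in> carrier (A i)
      \<Longrightarrow> \<phi> j l (\<phi> i j x) = \<phi> i l x"
begin

abbreviation "L \<equiv> direct_limit I A \<phi>"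

text \<open>The canonical map from the \<open>i\<close>-th ring to the direct limit.\<close>

definition \<iota> :: "'i \<Rightarrow> 'a \<Rightarrow> ('i \<times> 'a) set"
  where "\<iota> i x = dirlim_rel I A \<phi> `` {(i, x)}"

lemma \<phi>_closed: "i \<in> I \<Longrightarrow> j \<in> I \<Longrightarrow> i \<le> j \<Longrightarrow> x \<in> carrier (A i) \<Longrightarrow> \<phi> i j x \<in> carrier (A j)"
  using \<phi>_hom ring_hom_closed by fastforce

lemma upper_bound:
  assumes "i \<in> I" "j \<in> I" "l \<in> I"
  obtains m where "m \<in> I" "i \<le> m" "j \<le> m" "l \<le> m"
  using assms directed order_trans by metis

lemma equiv_rel: "equiv (SIGMA i:I. carrier (A i)) (dirlim_rel I A \<phi>)"
proof (rule equivI)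
  show "dirlim_rel I A \<phi> \<subseteq> (SIGMA i:I. carrier (A i)) \<times> (SIGMA i:I. carrier (A i))"
    unfolding dirlim_rel_def by auto
  show "refl_on (SIGMA i:I. carrier (A i)) (dirlim_rel I A \<phi>)"
    unfolding refl_on_def dirlim_rel_def by auto
  show "sym (dirlim_rel I A \<phi>)"
    unfolding sym_def dirlim_rel_def by auto
  have "((i, x), (l, z)) \<in> dirlim_rel I A \<phi>"
    if *: "((i, x), (j, y)) \<in> dirlim_rel I A \<phi>" "((j, y), (l, z)) \<in> dirlim_rel I A \<phi>"
    for i x j y l z
  proof -
    from * have carr: "i \<in> I" "x \<in> carrier (A i)" "j \<in> I" "y \<in> carrier (A j)" "l \<in> I"
        "z \<in> carrier (A l)"
      unfolding dirlim_rel_def by auto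
    from * obtain a b where ab: "a \<in> I" "i \<le> a" "j \<le> a" "\<phi> i a x = \<phi> j a y"
        "b \<in> I" "j \<le> b" "l \<le> b" "\<phi> j b y = \<phi> l b z"
      unfolding dirlim_rel_def by auto
    obtain m where m: "m \<in> I" "a \<le> m" "b \<le> m" using directed ab by blast
    have "\<phi> i m x = \<phi> a m (\<phi> j a y)"
      using \<phi>_comp[OF carr(1) ab(1) m(1) ab(2) m(2) carr(2)] ab(4) by simp
    also have "\<dots> = \<phi> b m (\<phi> j b y)"
      using \<phi>_comp[OF carr(3) ab(1) m(1) ab(3) m(2) carr(4)]
        \<phi>_comp[OF carr(3) ab(5) m(1) ab(6) m(3) carr(4)] by simp
    also have "\<dots> = \<phi> l m z"
      using \<phi>_comp[OF carr(5) ab(5) m(1) ab(7) m(3) carr(6)] ab(8) by simp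
    finally have "\<phi> i m x = \<phi> l m z" .
    moreover have "i \<le> m" "l \<le> m" using m ab order_trans by blast+
    ultimately show ?thesis using carr m(1) unfolding dirlim_rel_def by auto
  qed
  thus "trans (dirlim_rel I A \<phi>)" unfolding trans_def by auto
qed

lemma \<iota>_eq_iff:
  assumes "i \<in> I" "x \<in> carrier (A i)" "j \<in> I" "y \<in> carrier (A j)"
  shows "\<iota> i x = \<iota> j y \<longleftrightarrow> (\<exists>l \<in> I. i \<le> l \<and> j \<le> l \<and> \<phi> i l x = \<phi> j l y)"
proof -
  have "\<iota> i x = \<iota> j y \<longleftrightarrow> ((i, x), (j, y)) \<in> dirlim_rel I A \<phi>"
    unfolding \<iota>_def by (rule eq_equiv_class_iff[OF equiv_rel]) (use assms in auto)
  thus ?thesis using assms unfolding dirlim_rel_def by auto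
qed

lemma mem_\<iota>_iff:
  assumes "i \<in> I" "x \<in> carrier (A i)"
  shows "(j, y) \<in> \<iota> i x \<longleftrightarrow> j \<in> I \<and> y \<in> carrier (A j) \<and> \<iota> j y = \<iota> i x"
  using assms \<iota>_eq_iff[of i x j y] unfolding \<iota>_def dirlim_rel_def by auto

lemma \<iota>_\<phi>:
  assumes "i \<in> I" "j \<in> I" "i \<le> j" "x \<in> carrier (A i)"
  shows "\<iota> j (\<phi> i j x) = \<iota> i x"
  using assms \<iota>_eq_iff[of j "\<phi> i j x" i x] \<phi>_closed \<phi>_id by auto

lemma carrier_L: "carrier L = {\<iota> i x |i x. i \<in> I \<and> x \<in> carrier (A i)}"
  unfolding direct_limit_def quotient_def \<iota>_def by auto

lemma \<iota>_closed [simp]: "i \<in> I \<Longrightarrow> x \<in> carrier (A i) \<Longrightarrow> \<iota> i x \<in> carrier L"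
  unfolding carrier_L by blast

text \<open>The operation is a union over all representatives of the two classes and all common upper bounds of
  their indices. All members of this union are the same class, since two choices can be compared at a
  common upper bound of every index involved.\<close>

lemma dirlim_op_\<iota>:
  assumes closed: "\<And>i x y. i \<in> I \<Longrightarrow> x \<in> carrier (A i) \<Longrightarrow> y \<in> carrier (A i)
      \<Longrightarrow> f i x y \<in> carrier (A i)"
    and compat: "\<And>i j x y. i \<in> I \<Longrightarrow> j \<in> I \<Longrightarrow> i \<le> j \<Longrightarrow> x \<in> carrier (A i) \<Longrightarrow> y \<in> carrier (A i)
      \<Longrightarrow> \<phi> i j (f i x y) = f j (\<phi> i j x) (\<phi> i j y)"
    and l: "l \<in> I" and x: "x \<in> carrier (A l)" and y: "y \<in> carrier (A l)"
  shows "dirlim_op I A \<phi> f (\<iota> l x) (\<iota> l y) = \<iota> l (f l x y)"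
proof -
  let ?\<S> = "{dirlim_rel I A \<phi> `` {(m, f m (\<phi> i m x') (\<phi> j m y'))} |i j m x' y'.
        (i, x') \<in> \<iota> l x \<and> (j, y') \<in> \<iota> l y \<and> m \<in> I \<and> i \<le> m \<and> j \<le> m}"
  have Union_eqI: "\<Union>\<S> = T" if "\<And>S. S \<in> \<S> \<Longrightarrow> S = T" "T \<in> \<S>"
    for \<S> and T :: "('i \<times> 'a) set"
    using that by blast
  show ?thesis
    unfolding dirlim_op_def
  proof (rule Union_eqI)
    fix S assume "S \<in> ?\<S>"
    then obtain i j m x' y'
      where S: "S = dirlim_rel I A \<phi> `` {(m, f m (\<phi> i m x') (\<phi> j m y'))}"
      and mem: "(i, x') \<in> \<iota> l x" "(j, y') \<in> \<iota> l y" and m: "m \<in> I" "i \<le> m" "j \<le> m"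
      by (elim CollectE exE conjE)
    from mem have i: "i \<in> I" "x' \<in> carrier (A i)" and j: "j \<in> I" "y' \<in> carrier (A j)"
      and eq: "\<iota> i x' = \<iota> l x" "\<iota> j y' = \<iota> l y"
      using mem_\<iota>_iff[OF l x] mem_\<iota>_iff[OF l y] by auto
    from eq(1) obtain a where a: "a \<in> I" "i \<le> a" "l \<le> a" "\<phi> i a x' = \<phi> l a x"
      unfolding \<iota>_eq_iff[OF i l x] by (elim bexE conjE)
    from eq(2) obtain b where b: "b \<in> I" "j \<le> b" "l \<le> b" "\<phi> j b y' = \<phi> l b y"
      unfolding \<iota>_eq_iff[OF j l y] by (elim bexE conjE)
    obtain c where c: "c \<in> I" "a \<le> c" "b \<le> c" "m \<le> c"
      by (rule upper_bound[OF a(1) b(1) m(1)])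
    have lc: "l \<le> c" using a c order_trans by blast
    have X: "\<phi> m c (\<phi> i m x') = \<phi> l c x"
      using \<phi>_comp[OF i(1) m(1) c(1) m(2) c(4) i(2)] \<phi>_comp[OF i(1) a(1) c(1) a(2) c(2) i(2)]
        \<phi>_comp[OF l a(1) c(1) a(3) c(2) x] a(4) by simp
    have Y: "\<phi> m c (\<phi> j m y') = \<phi> l c y"
      using \<phi>_comp[OF j(1) m(1) c(1) m(3) c(4) j(2)] \<phi>_comp[OF j(1) b(1) c(1) b(2) c(3) j(2)]
        \<phi>_comp[OF l b(1) c(1) b(3) c(3) y] b(4) by simp
    have carr: "\<phi> i m x' \<in> carrier (A m)" "\<phi> j m y' \<in> carrier (A m)"
      using \<phi>_closed i j m by auto
    have "\<phi> m c (f m (\<phi> i m x') (\<phi> j m y')) = \<phi> l c (f l x y)"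
      using compat[OF m(1) c(1,4) carr] compat[OF l c(1) lc x y] X Y by simp
    thus "S = \<iota> l (f l x y)"
      unfolding S \<iota>_def[symmetric]
      using \<iota>_eq_iff[OF m(1) closed[OF m(1) carr] l closed[OF l x y]] c(1,4) lc by auto
  next
    have "(l, x) \<in> \<iota> l x" "(l, y) \<in> \<iota> l y"
      using mem_\<iota>_iff[OF l x] mem_\<iota>_iff[OF l y] l x y by simp_all
    moreover have "\<iota> l (f l x y) = dirlim_rel I A \<phi> `` {(l, f l (\<phi> l l x) (\<phi> l l y))}"
      unfolding \<iota>_def using \<phi>_id l x y by simp
    ultimately show "\<iota> l (f l x y) \<in> ?\<S>"
      using l order_refl[of l] by (intro CollectI exI conjI) assumption+
  qed
qed

lemma mult_\<iota>:
  assumes "l \<in> I" "x \<in> carrier (A l)" "y \<in> carrier (A l)"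
  shows "\<iota> l x \<otimes>\<^bsub>L\<^esub> \<iota> l y = \<iota> l (x \<otimes>\<^bsub>A l\<^esub> y)"
proof -
  have "dirlim_op I A \<phi> (\<lambda>l. monoid.mult (A l)) (\<iota> l x) (\<iota> l y) = \<iota> l (x \<otimes>\<^bsub>A l\<^esub> y)"
    by (rule dirlim_op_\<iota>[where f = "\<lambda>l. monoid.mult (A l)", OF monoid.m_closed[OF ring.is_monoid[OF cring.axioms(1)[OF cring_A]]]
          ring_hom_mult[OF \<phi>_hom] assms])
  thus ?thesis unfolding direct_limit_def by simp
qed

lemma add_\<iota>:
  assumes "l \<in> I" "x \<in> carrier (A l)" "y \<in> carrier (A l)"
  shows "\<iota> l x \<oplus>\<^bsub>L\<^esub> \<iota> l y = \<iota> l (x \<oplus>\<^bsub>A l\<^esub> y)"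
proof -
  have "dirlim_op I A \<phi> (\<lambda>l. ring.add (A l)) (\<iota> l x) (\<iota> l y) = \<iota> l (x \<oplus>\<^bsub>A l\<^esub> y)"
    by (rule dirlim_op_\<iota>[where f = "\<lambda>l. ring.add (A l)", OF ring.ring_simprules(1)[OF cring.axioms(1)[OF cring_A]]
          ring_hom_add[OF \<phi>_hom] assms])
  thus ?thesis unfolding direct_limit_def by simp
qed

lemma \<iota>_const:
  assumes c: "\<And>i. i \<in> I \<Longrightarrow> c i \<in> carrier (A i)"
    and \<phi>c: "\<And>i j. i \<in> I \<Longrightarrow> j \<in> I \<Longrightarrow> i \<le> j \<Longrightarrow> \<phi> i j (c i) = c j"
    and l: "l \<in> I"
  shows "(\<Union>i \<in> I. dirlim_rel I A \<phi> `` {(i, c i)}) = \<iota> l (c l)"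
proof -
  have "\<iota> i (c i) = \<iota> l (c l)" if i: "i \<in> I" for i
  proof -
    obtain m where m: "m \<in> I" "i \<le> m" "l \<le> m" using directed i l by blast
    thus ?thesis
      using \<iota>_eq_iff[OF i c[OF i] l c[OF l]] \<phi>c[OF i m(1,2)] \<phi>c[OF l m(1,3)] by auto
  qed
  hence "(\<Union>i \<in> I. \<iota> i (c i)) = (\<Union>i \<in> I. \<iota> l (c l))" by simp
  thus ?thesis using l unfolding \<iota>_def by auto
qed

lemma one_\<iota>:
  assumes "l \<in> I"
  shows "\<one>\<^bsub>L\<^esub> = \<iota> l \<one>\<^bsub>A l\<^esub>"
proof -
  have "(\<Union>i \<in> I. dirlim_rel I A \<phi> `` {(i, \<one>\<^bsub>A i\<^esub>)}) = \<iota> l \<one>\<^bsub>A l\<^esub>"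
    by (rule \<iota>_const[where c = "\<lambda>i. \<one>\<^bsub>A i\<^esub>", OF monoid.one_closed[OF ring.is_monoid[OF cring.axioms(1)[OF cring_A]]]
          ring_hom_one[OF \<phi>_hom] assms])
  thus ?thesis unfolding direct_limit_def by simp
qed

lemma zero_\<iota>:
  assumes "l \<in> I"
  shows "\<zero>\<^bsub>L\<^esub> = \<iota> l \<zero>\<^bsub>A l\<^esub>"
proof -
  have "(\<Union>i \<in> I. dirlim_rel I A \<phi> `` {(i, \<zero>\<^bsub>A i\<^esub>)}) = \<iota> l \<zero>\<^bsub>A l\<^esub>"
  proof (rule \<iota>_const[OF _ _ assms])
    fix i j assume "i \<in> I" "j \<in> I" "i \<le> j"
    thus "\<phi> i j \<zero>\<^bsub>A i\<^esub> = \<zero>\<^bsub>A j\<^esub>"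
      by (intro ring_hom_zero[OF \<phi>_hom] cring.axioms(1)[OF cring_A])
  qed (rule ring.ring_simprules(2)[OF cring.axioms(1)[OF cring_A]])
  thus ?thesis unfolding direct_limit_def by simp
qed

text \<open>By directedness, finitely many elements of the limit come from one ring of the system. Hence a ring
  axiom, or a polynomial together with an approximate root, can be treated at a single index.\<close>

lemma lift_list:
  assumes "set ps \<subseteq> carrier L"
  shows "\<exists>l \<in> I. \<exists>qs. set qs \<subseteq> carrier (A l) \<and> ps = map (\<iota> l) qs"
  using assms
proof (induction ps)
  case Nil
  show ?case using nonempty by auto
next
  case (Cons P ps)
  from Cons.prems have "set ps \<subseteq> carrier L" "P \<in> carrier L" by simp_all
  from Cons.IH[OF this(1)] obtain l qs
    where l: "l \<in> I" and qs: "set qs \<subseteq> carrier (A l)" "ps = map (\<iota> l) qs"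
    by (elim bexE exE conjE)
  from \<open>P \<in> carrier L\<close> obtain j x where j: "j \<in> I" "x \<in> carrier (A j)" "P = \<iota> j x"
    unfolding carrier_L by (elim CollectE exE conjE)
  obtain m where m: "m \<in> I" "l \<le> m" "j \<le> m" using directed[OF l j(1)] by (elim bexE conjE)
  have "map (\<iota> m) (map (\<phi> l m) qs) = ps"
    unfolding qs(2) map_map using \<iota>_\<phi>[OF l m(1,2)] qs(1) by (intro map_cong) auto
  moreover have "\<iota> m (\<phi> j m x) = P" using \<iota>_\<phi>[OF j(1) m(1,3) j(2)] j(3) by simp
  ultimately have "P # ps = map (\<iota> m) (\<phi> j m x # map (\<phi> l m) qs)" by simp
  moreover have "set (\<phi> j m x # map (\<phi> l m) qs) \<subseteq> carrier (A m)"
    using \<phi>_closed[OF l m(1,2)] \<phi>_closed[OF j(1) m(1,3) j(2)] qs(1) by auto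
  ultimately show ?case by (intro bexI[OF _ m(1)] exI conjI)
qed

lemma lift3:
  assumes "x \<in> carrier L" "y \<in> carrier L" "z \<in> carrier L"
  obtains l a b c where "l \<in> I" "a \<in> carrier (A l)" "b \<in> carrier (A l)" "c \<in> carrier (A l)"
    "x = \<iota> l a" "y = \<iota> l b" "z = \<iota> l c"
proof -
  have "set [x, y, z] \<subseteq> carrier L" using assms by simp
  then obtain l qs where l: "l \<in> I" and qs: "set qs \<subseteq> carrier (A l)" "[x, y, z] = map (\<iota> l) qs"
    by (elim lift_list[THEN bexE] exE conjE)
  have len: "length qs = 3" using arg_cong[OF qs(2), of length] by simp
  have nth: "[x, y, z] ! i = \<iota> l (qs ! i)" and carr: "qs ! i \<in> carrier (A l)" if "i < 3" for i
    using that len qs(1) nth_mem[of i qs] unfolding qs(2) by auto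
  show ?thesis
    by (rule that[OF l carr[of 0] carr[of 1] carr[of 2]])
      (use nth[of 0] nth[of 1] nth[of 2] in simp_all)
qed

lemma cring_L: "cring L"
proof (rule cringI)
  show "abelian_group L"
  proof (rule abelian_groupI)
    fix x y z assume x: "x \<in> carrier L" and y: "y \<in> carrier L" and z: "z \<in> carrier L"
    then obtain l a b c where l: "l \<in> I" and abc: "a \<in> carrier (A l)" "b \<in> carrier (A l)"
        "c \<in> carrier (A l)" "x = \<iota> l a" "y = \<iota> l b" "z = \<iota> l c" by (rule lift3)
    interpret A: cring "A l" by (rule cring_A[OF l])
    show "x \<oplus>\<^bsub>L\<^esub> y \<oplus>\<^bsub>L\<^esub> z = x \<oplus>\<^bsub>L\<^esub> (y \<oplus>\<^bsub>L\<^esub> z)"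
      using l abc by (simp add: add_\<iota> A.a_assoc)
  next
    fix x y assume x: "x \<in> carrier L" and y: "y \<in> carrier L"
    obtain l a b c where l: "l \<in> I" and abc: "a \<in> carrier (A l)" "b \<in> carrier (A l)"
        "x = \<iota> l a" "y = \<iota> l b" by (rule lift3[OF x y y])
    interpret A: cring "A l" by (rule cring_A[OF l])
    show "x \<oplus>\<^bsub>L\<^esub> y \<in> carrier L" "x \<oplus>\<^bsub>L\<^esub> y = y \<oplus>\<^bsub>L\<^esub> x"
      using l abc by (simp_all add: add_\<iota> A.a_comm)
  next
    obtain l where l: "l \<in> I" using nonempty by blast
    interpret A: cring "A l" by (rule cring_A[OF l])
    show "\<zero>\<^bsub>L\<^esub> \<in> carrier L" using l by (simp add: zero_\<iota>)
  next
    fix x assume x: "x \<in> carrier L"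
    obtain l a where l: "l \<in> I" and a: "a \<in> carrier (A l)" "x = \<iota> l a"
      by (rule lift3[OF x x x])
    interpret A: cring "A l" by (rule cring_A[OF l])
    show "\<zero>\<^bsub>L\<^esub> \<oplus>\<^bsub>L\<^esub> x = x" using l a by (simp add: add_\<iota> zero_\<iota>)
    show "\<exists>y \<in> carrier L. y \<oplus>\<^bsub>L\<^esub> x = \<zero>\<^bsub>L\<^esub>"
      using l a by (intro bexI[of _ "\<iota> l (\<ominus>\<^bsub>A l\<^esub> a)"]) (simp_all add: add_\<iota> zero_\<iota> A.l_neg)
  qed
  show "comm_monoid L"
  proof (rule comm_monoidI)
    fix x y z assume x: "x \<in> carrier L" and y: "y \<in> carrier L" and z: "z \<in> carrier L"
    then obtain l a b c where l: "l \<in> I" and abc: "a \<in> carrier (A l)" "b \<in> carrier (A l)"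
        "c \<in> carrier (A l)" "x = \<iota> l a" "y = \<iota> l b" "z = \<iota> l c" by (rule lift3)
    interpret A: cring "A l" by (rule cring_A[OF l])
    show "x \<otimes>\<^bsub>L\<^esub> y \<otimes>\<^bsub>L\<^esub> z = x \<otimes>\<^bsub>L\<^esub> (y \<otimes>\<^bsub>L\<^esub> z)"
      using l abc by (simp add: mult_\<iota> A.m_assoc)
  next
    fix x y assume x: "x \<in> carrier L" and y: "y \<in> carrier L"
    obtain l a b c where l: "l \<in> I" and abc: "a \<in> carrier (A l)" "b \<in> carrier (A l)"
        "x = \<iota> l a" "y = \<iota> l b" by (rule lift3[OF x y y])
    interpret A: cring "A l" by (rule cring_A[OF l])
    show "x \<otimes>\<^bsub>L\<^esub> y \<in> carrier L" "x \<otimes>\<^bsub>L\<^esub> y = y \<otimes>\<^bsub>L\<^esub> x"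
      using l abc by (simp_all add: mult_\<iota> A.m_comm)
  next
    obtain l where l: "l \<in> I" using nonempty by blast
    interpret A: cring "A l" by (rule cring_A[OF l])
    show "\<one>\<^bsub>L\<^esub> \<in> carrier L" using l by (simp add: one_\<iota>)
  next
    fix x assume x: "x \<in> carrier L"
    obtain l a where l: "l \<in> I" and a: "a \<in> carrier (A l)" "x = \<iota> l a"
      by (rule lift3[OF x x x])
    interpret A: cring "A l" by (rule cring_A[OF l])
    show "\<one>\<^bsub>L\<^esub> \<otimes>\<^bsub>L\<^esub> x = x" using l a by (simp add: mult_\<iota> one_\<iota>)
  qed
  fix x y z assume x: "x \<in> carrier L" and y: "y \<in> carrier L" and z: "z \<in> carrier L"
  then obtain l a b c where l: "l \<in> I" and abc: "a \<in> carrier (A l)" "b \<in> carrier (A l)"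
      "c \<in> carrier (A l)" "x = \<iota> l a" "y = \<iota> l b" "z = \<iota> l c" by (rule lift3)
  interpret A: cring "A l" by (rule cring_A[OF l])
  show "(x \<oplus>\<^bsub>L\<^esub> y) \<otimes>\<^bsub>L\<^esub> z = x \<otimes>\<^bsub>L\<^esub> z \<oplus>\<^bsub>L\<^esub> y \<otimes>\<^bsub>L\<^esub> z"
    using l abc by (simp add: mult_\<iota> add_\<iota> A.l_distr)
qed

lemma \<iota>_hom: "i \<in> I \<Longrightarrow> ring_hom_cring (A i) L (\<iota> i)"
  by (intro ring_hom_cring.intro ring_hom_cring_axioms.intro cring_A cring_L ring_hom_memI)
    (simp_all add: mult_\<iota> add_\<iota> one_\<iota>)

text \<open>A polynomial over the limit and an approximate root of it come from some \<open>A l\<close>. If the transition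
  maps reflect units, so do the maps to the limit: an equation \<open>x y = 1\<close> in the limit already holds
  at some index. Thus a simple approximate root in the limit is one in \<open>A l\<close>, where it lifts to a
  root, and the image of this root is a root in the limit. Likewise a sum of two nonunits is formed in
  some \<open>A l\<close>, and so the limit is local.\<close>

lemma henselian_direct_limit:
  assumes local: "\<And>i. i \<in> I \<Longrightarrow> local_ring (A i)"
    and lift: "\<And>i. i \<in> I \<Longrightarrow> simple_roots_lift (A i)"
    and reflect: "\<And>i j x. i \<in> I \<Longrightarrow> j \<in> I \<Longrightarrow> i \<le> j \<Longrightarrow> x \<in> carrier (A i)
      \<Longrightarrow> \<phi> i j x \<in> Units (A j) \<Longrightarrow> x \<in> Units (A i)"
  shows "henselian L"
proof -
  interpret L: cring L by (rule cring_L)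
  have unit_iff: "\<iota> i x \<in> Units L \<longleftrightarrow> x \<in> Units (A i)" if i: "i \<in> I" and x: "x \<in> carrier (A i)" for i x
  proof
    assume "\<iota> i x \<in> Units L"
    then obtain Y where Y: "Y \<in> carrier L" "\<iota> i x \<otimes>\<^bsub>L\<^esub> Y = \<one>\<^bsub>L\<^esub>" unfolding Units_def by blast
    from Y(1) obtain j y where j: "j \<in> I" "y \<in> carrier (A j)" "Y = \<iota> j y"
      unfolding carrier_L by auto
    obtain m where m: "m \<in> I" "i \<le> m" "j \<le> m" using directed i j by blast
    interpret m: cring "A m" by (rule cring_A[OF m(1)])
    let ?x = "\<phi> i m x" and ?y = "\<phi> j m y"
    have carr: "?x \<in> carrier (A m)" "?y \<in> carrier (A m)" using \<phi>_closed i x j m by auto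
    have "\<iota> m (?x \<otimes>\<^bsub>A m\<^esub> ?y) = \<iota> m \<one>\<^bsub>A m\<^esub>"
      unfolding mult_\<iota>[OF m(1) carr, symmetric] one_\<iota>[OF m(1), symmetric]
        \<iota>_\<phi>[OF i m(1,2) x] \<iota>_\<phi>[OF j(1) m(1,3) j(2)] j(3)[symmetric] by (rule Y(2))
    hence "\<exists>n \<in> I. m \<le> n \<and> m \<le> n \<and> \<phi> m n (?x \<otimes>\<^bsub>A m\<^esub> ?y) = \<phi> m n \<one>\<^bsub>A m\<^esub>"
      by (rule iffD1[OF \<iota>_eq_iff[OF m(1) m.m_closed[OF carr] m(1) m.one_closed]])
    then obtain n where n: "n \<in> I" "m \<le> n" "\<phi> m n (?x \<otimes>\<^bsub>A m\<^esub> ?y) = \<phi> m n \<one>\<^bsub>A m\<^esub>"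
      by blast
    interpret n: cring "A n" by (rule cring_A[OF n(1)])
    have "\<phi> m n ?x \<otimes>\<^bsub>A n\<^esub> \<phi> m n ?y = \<one>\<^bsub>A n\<^esub>"
      using n(3) ring_hom_mult[OF \<phi>_hom[OF m(1) n(1,2)] carr]
        ring_hom_one[OF \<phi>_hom[OF m(1) n(1,2)]] by simp
    hence "\<phi> m n ?x \<in> Units (A n)"
      by (intro n.unit_factor[OF \<phi>_closed[OF m(1) n(1,2) carr(1)]
            \<phi>_closed[OF m(1) n(1,2) carr(2)]]) (simp only: n.Units_one_closed)
    thus "x \<in> Units (A i)" by (rule reflect[OF i m(1,2) x reflect[OF m(1) n(1,2) carr(1)]])
  next
    interpret \<iota>: ring_hom_cring "A i" L "\<iota> i" by (rule \<iota>_hom[OF i])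
    assume u: "x \<in> Units (A i)"
    have inv: "inv\<^bsub>A i\<^esub> x \<in> carrier (A i)" using u by simp
    have "\<iota> i x \<otimes>\<^bsub>L\<^esub> \<iota> i (inv\<^bsub>A i\<^esub> x) = \<one>\<^bsub>L\<^esub>"
      using \<iota>.hom_mult[OF x inv] u by simp
    thus "\<iota> i x \<in> Units L"
      using L.unit_factor[of "\<iota> i x" "\<iota> i (inv\<^bsub>A i\<^esub> x)"] i x inv by simp
  qed
  have "local_ring L"
  proof (rule L.local_ringI)
    obtain i where i: "i \<in> I" using nonempty by blast
    interpret i: cring "A i" by (rule cring_A[OF i])
    have "\<zero>\<^bsub>A i\<^esub> \<in> max_ideal (A i)"
      by (rule additive_subgroup.zero_closed[OF ideal.axioms(1)[OF maximalideal.axioms(1)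
          [OF local_ring_maximalideal(1)[OF local[OF i]]]]])
    hence "\<zero>\<^bsub>A i\<^esub> \<notin> Units (A i)" unfolding max_ideal_eq_nonunits[OF local[OF i]] by blast
    hence "\<zero>\<^bsub>L\<^esub> \<notin> Units L" using unit_iff[OF i] zero_\<iota>[OF i] by simp
    thus "\<one>\<^bsub>L\<^esub> \<noteq> \<zero>\<^bsub>L\<^esub>" using L.Units_one_closed by metis
  next
    fix x y assume x: "x \<in> carrier L - Units L" and y: "y \<in> carrier L - Units L"
    obtain l a b c where l: "l \<in> I" and ab: "a \<in> carrier (A l)" "b \<in> carrier (A l)"
        "x = \<iota> l a" "y = \<iota> l b"
      using x y by (elim DiffE) (rule lift3[of x y y])
    have M: "additive_subgroup (max_ideal (A l)) (A l)"
      by (rule ideal.axioms(1)[OF maximalideal.axioms(1)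
          [OF local_ring_maximalideal(1)[OF local[OF l]]]])
    have "a \<in> max_ideal (A l)" "b \<in> max_ideal (A l)"
      using x y ab unit_iff[OF l] unfolding max_ideal_eq_nonunits[OF local[OF l]] by auto
    hence "a \<oplus>\<^bsub>A l\<^esub> b \<in> max_ideal (A l)" by (rule additive_subgroup.a_closed[OF M])
    thus "x \<oplus>\<^bsub>L\<^esub> y \<notin> Units L"
      using unit_iff[OF l] ab l unfolding max_ideal_eq_nonunits[OF local[OF l]]
      by (simp add: add_\<iota>)
  qed
  moreover have "\<exists>a \<in> carrier L. L.eval p a = \<zero>\<^bsub>L\<^esub> \<and> a \<ominus>\<^bsub>L\<^esub> x \<notin> Units L"
    if p: "set p \<subseteq> carrier L" "p \<noteq> []" "lead_coeff p = \<one>\<^bsub>L\<^esub>" and x: "x \<in> carrier L"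
      and root: "L.eval p x \<notin> Units L" and simple: "L.eval (poly_deriv L p) x \<in> Units L" for p x
  proof -
    have "set (x # tl p) \<subseteq> carrier L" using p(1,2) x by (cases p) auto
    then obtain l ys where l: "l \<in> I" and ys: "set ys \<subseteq> carrier (A l)" "x # tl p = map (\<iota> l) ys"
      by (elim lift_list[THEN bexE] exE conjE)
    from ys(2) obtain y r where yr: "ys = y # r" "x = \<iota> l y" "tl p = map (\<iota> l) r"
      unfolding Cons_eq_map_conv by (elim exE conjE)
    have y: "y \<in> carrier (A l)" and r: "set r \<subseteq> carrier (A l)"
      using ys(1) unfolding yr(1) by simp_all
    interpret \<iota>: ring_hom_cring "A l" L "\<iota> l" by (rule \<iota>_hom[OF l])
    \<comment> \<open>An arbitrary preimage of the leading coefficient need not be \<open>\<one>\<close>, so \<open>\<one>\<close> is chosen.\<close>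
    define q where "q = \<one>\<^bsub>A l\<^esub> # r"
    have qA: "set q \<subseteq> carrier (A l)"
      unfolding q_def using r by simp
    have pq: "p = map (\<iota> l) q"
      using list.collapse[OF p(2)] unfolding q_def p(3) yr(3) one_\<iota>[OF l] by simp
    have "\<iota> l (\<iota>.R.eval q y) \<notin> Units L"
      using root unfolding pq yr(2) \<iota>.ring.eval_hom'[OF y qA] .
    hence root': "\<iota>.R.eval q y \<notin> Units (A l)"
      unfolding unit_iff[OF l \<iota>.R.eval_in_carrier[OF qA y]] .
    have "\<iota> l (\<iota>.R.eval (poly_deriv (A l) q) y) \<in> Units L"
      using simple unfolding pq yr(2) \<iota>.ring.hom_eval_poly_deriv[OF qA y] .
    hence simple': "\<iota>.R.eval (poly_deriv (A l) q) y \<in> Units (A l)"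
      unfolding unit_iff[OF l \<iota>.R.eval_in_carrier[OF \<iota>.R.poly_deriv_in_carrier[OF qA] y]] .
    have "q \<noteq> []" "lead_coeff q = \<one>\<^bsub>A l\<^esub>" unfolding q_def by simp_all
    hence "\<exists>a \<in> carrier (A l). \<iota>.R.eval q a = \<zero>\<^bsub>A l\<^esub> \<and> a \<ominus>\<^bsub>A l\<^esub> y \<notin> Units (A l)"
      using qA y root' simple'
      by (intro lift[OF l, unfolded simple_roots_lift_def, rule_format] conjI)
    then obtain a where a: "a \<in> carrier (A l)" "\<iota>.R.eval q a = \<zero>\<^bsub>A l\<^esub>"
        "a \<ominus>\<^bsub>A l\<^esub> y \<notin> Units (A l)"
      by (elim bexE conjE)
    have "L.eval p (\<iota> l a) = \<zero>\<^bsub>L\<^esub>"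
      unfolding pq \<iota>.ring.eval_hom'[OF a(1) qA, symmetric] a(2) by (rule \<iota>.hom_zero)
    moreover have "\<iota> l (a \<ominus>\<^bsub>A l\<^esub> y) \<notin> Units L"
      using a(3) unfolding unit_iff[OF l \<iota>.R.minus_closed[OF a(1) y]] .
    moreover have "\<iota> l (a \<ominus>\<^bsub>A l\<^esub> y) = \<iota> l a \<ominus>\<^bsub>L\<^esub> x"
      unfolding yr(2) a_minus_def using a(1) y by simp
    ultimately show ?thesis using \<iota>_closed[OF l a(1)] by (intro bexI[of _ "\<iota> l a"]) simp_all
  qed
  hence "simple_roots_lift L" unfolding simple_roots_lift_def by blast
  ultimately show ?thesis by (rule henselian_if_simple_roots_lift)
qed

end

section \<open>Functoriality of completion\<close>

text \<open>An inclusion of local rings in which \<open>S\<close> dominates \<open>R\<close>. Stating the inclusion as a homomorphism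
  allows \<open>R\<close> and \<open>S\<close> to be different records on the same type.\<close>

locale local_extension = R: local_cring R + S: local_cring S
  for R :: "('a, 'b) ring_scheme" and S :: "('a, 'c) ring_scheme" +
  assumes inclusion: "(\<lambda>x. x) \<in> ring_hom R S"
    and max_ideal_inter: "max_ideal S \<inter> carrier R = max_ideal R"
begin

sublocale inclusion: ring_hom_cring R S "\<lambda>x. x"
  by (intro ring_hom_cring.intro ring_hom_cring_axioms.intro R.is_cring S.is_cring inclusion)

lemma M_pow_subset: "R.M_pow n \<subseteq> S.M_pow n"
proof (induction n)
  case 0
  show ?case unfolding R.M_pow_0 S.M_pow_0 using inclusion.hom_closed by blast
next
  case (Suc n)
  have M: "max_ideal R \<subseteq> max_ideal S" using max_ideal_inter by blast
  have carr: "R.M_pow n \<subseteq> carrier R" "max_ideal R \<subseteq> carrier R"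
    using ideal.Icarr[OF R.ideal_M_pow] ideal.Icarr[OF R.ideal_max] by blast+
  have "x \<in> ideal_prod S (S.M_pow n) (max_ideal S)"
    if "x \<in> ideal_prod R (R.M_pow n) (max_ideal R)" for x
    using that
  proof (induction rule: ideal_prod.induct)
    case (prod i j)
    hence "i \<otimes>\<^bsub>R\<^esub> j = i \<otimes>\<^bsub>S\<^esub> j" using inclusion.hom_mult[of i j] carr by blast
    moreover have "i \<otimes>\<^bsub>S\<^esub> j \<in> ideal_prod S (S.M_pow n) (max_ideal S)"
      using prod Suc M by (intro ideal_prod.prod) auto
    ultimately show ?case by simp
  next
    case (sum x y)
    have "x \<in> carrier R" "y \<in> carrier R"
      using sum.hyps R.ideal_prod_in_carrier[OF R.ideal_M_pow R.ideal_max] by blast+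
    hence "x \<oplus>\<^bsub>R\<^esub> y = x \<oplus>\<^bsub>S\<^esub> y" using inclusion.hom_add[of x y] by blast
    thus ?case using ideal_prod.sum[OF sum.IH] by simp
  qed
  thus ?case unfolding R.M_pow_Suc S.M_pow_Suc by blast
qed

lemma coherent_extension:
  assumes r: "R.coherent r"
  shows "S.coherent r"
proof -
  have "r m \<ominus>\<^bsub>S\<^esub> r n \<in> S.M_pow n" if nm: "n \<le> m" for n m
  proof -
    have "r m \<ominus>\<^bsub>R\<^esub> r n = r m \<ominus>\<^bsub>S\<^esub> r n"
      unfolding a_minus_def inclusion.hom_a_inv[OF R.coherentD(1)[OF r], symmetric]
      by (rule inclusion.hom_add[OF R.coherentD(1)[OF r] R.a_inv_closed[OF R.coherentD(1)[OF r]]])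
    thus ?thesis using R.coherentD(2)[OF r nm] M_pow_subset[of n] by auto
  qed
  thus ?thesis
    using R.coherentD(1)[OF r] inclusion.hom_closed unfolding S.coherent_def by blast
qed

text \<open>The natural map on completions leaves sequences of representatives unchanged. Functoriality and
  compatibility with the operations follow at once.\<close>

lemma completion_map_cosets:
  assumes r: "R.coherent r"
  shows "completion_map S (R.cosets r) = S.cosets r"
proof
  have UN_eqI: "(\<Union>x \<in> A. F x) = B" if "\<And>x. x \<in> A \<Longrightarrow> F x = B" "a \<in> A"
    for A :: "'a set" and F and B :: "'a set" and a
    using that by blast
  fix n
  have rR: "r n \<in> carrier R" and rS: "r n \<in> carrier S"
    using R.coherentD(1)[OF r] S.coherentD(1)[OF coherent_extension[OF r]] by blast+
  have "S.M_pow n +>\<^bsub>S\<^esub> x = S.M_pow n +>\<^bsub>S\<^esub> r n" if x: "x \<in> R.M_pow n +>\<^bsub>R\<^esub> r n" for x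
  proof -
    from x obtain h where h: "h \<in> R.M_pow n" "x = h \<oplus>\<^bsub>R\<^esub> r n"
      unfolding a_r_coset_def r_coset_def by auto
    have "x = h \<oplus>\<^bsub>S\<^esub> r n"
      using h inclusion.hom_add[OF ideal.Icarr[OF R.ideal_M_pow h(1)] rR] by simp
    moreover have hS: "h \<in> S.M_pow n" using h(1) M_pow_subset by blast
    ultimately have "x \<in> S.M_pow n +>\<^bsub>S\<^esub> r n"
      unfolding a_r_coset_def r_coset_def by auto
    thus ?thesis
      using abelian_subgroup.a_repr_independence'[OF S.abelian_subgroup_M_pow _ rS] by blast
  qed
  moreover have "r n \<in> R.M_pow n +>\<^bsub>R\<^esub> r n"
    by (rule abelian_subgroup.a_rcos_self[OF R.abelian_subgroup_M_pow rR])
  ultimately have "(\<Union>x \<in> R.M_pow n +>\<^bsub>R\<^esub> r n. S.M_pow n +>\<^bsub>S\<^esub> x) = S.M_pow n +>\<^bsub>S\<^esub> r n"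
    by (rule UN_eqI)
  thus "completion_map S (R.cosets r) n = S.cosets r n"
    unfolding completion_map_def R.cosets_def S.cosets_def S.M_pow_def[symmetric] .
qed

lemma completion_map_hom: "completion_map S \<in> ring_hom R.C S.C"
proof (rule ring_hom_memI)
  fix f assume "f \<in> carrier R.C"
  then obtain r where r: "R.coherent r" "f = R.cosets r" unfolding R.carrier_completion by blast
  show "completion_map S f \<in> carrier S.C"
    unfolding r(2) completion_map_cosets[OF r(1)] S.carrier_completion
    using coherent_extension[OF r(1)] by blast
next
  fix f g assume "f \<in> carrier R.C" "g \<in> carrier R.C"
  then obtain r s where r: "R.coherent r" "f = R.cosets r" and s: "R.coherent s" "g = R.cosets s"
    unfolding R.carrier_completion by blast
  note rS = coherent_extension[OF r(1)] and sS = coherent_extension[OF s(1)]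
  have "(\<lambda>n. r n \<otimes>\<^bsub>R\<^esub> s n) = (\<lambda>n. r n \<otimes>\<^bsub>S\<^esub> s n)"
    using R.coherentD(1)[OF r(1)] R.coherentD(1)[OF s(1)] inclusion.hom_mult by blast
  thus "completion_map S (f \<otimes>\<^bsub>R.C\<^esub> g) = completion_map S f \<otimes>\<^bsub>S.C\<^esub> completion_map S g"
    using completion_map_cosets[OF R.coherent_mult(1)[OF r(1) s(1)]]
    unfolding r(2) s(2) R.coherent_mult(2)[OF r(1) s(1)] completion_map_cosets[OF r(1)]
      completion_map_cosets[OF s(1)] S.coherent_mult(2)[OF rS sS] by simp
  have "(\<lambda>n. r n \<oplus>\<^bsub>R\<^esub> s n) = (\<lambda>n. r n \<oplus>\<^bsub>S\<^esub> s n)"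
    using R.coherentD(1)[OF r(1)] R.coherentD(1)[OF s(1)] inclusion.hom_add by blast
  thus "completion_map S (f \<oplus>\<^bsub>R.C\<^esub> g) = completion_map S f \<oplus>\<^bsub>S.C\<^esub> completion_map S g"
    using completion_map_cosets[OF R.coherent_add(1)[OF r(1) s(1)]]
    unfolding r(2) s(2) R.coherent_add(2)[OF r(1) s(1)] completion_map_cosets[OF r(1)]
      completion_map_cosets[OF s(1)] S.coherent_add(2)[OF rS sS] by simp
next
  show "completion_map S \<one>\<^bsub>R.C\<^esub> = \<one>\<^bsub>S.C\<^esub>"
    using completion_map_cosets[OF R.coherent_const[OF R.one_closed]]
    by (simp only: R.one_completion S.one_completion inclusion.hom_one)
qed

text \<open>Whether an element of a completion is a unit depends only on its first representative, which the map
  does not change. Domination says that a nonunit of \<open>R\<close> is a nonunit of \<open>S\<close>.\<close>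

lemma completion_map_reflects_units:
  assumes f: "f \<in> carrier R.C" and u: "completion_map S f \<in> Units S.C"
  shows "f \<in> Units R.C"
proof -
  obtain r where r: "R.coherent r" "f = R.cosets r" using f unfolding R.carrier_completion by blast
  have "r 1 \<in> Units S"
    using u S.completion_unit_iff[OF coherent_extension[OF r(1)]]
    unfolding r(2) completion_map_cosets[OF r(1)] by blast
  hence "r 1 \<notin> max_ideal R"
    using max_ideal_inter unfolding max_ideal_eq_nonunits[OF S.local] by blast
  hence "r 1 \<in> Units R"
    using R.coherentD(1)[OF r(1)] unfolding max_ideal_eq_nonunits[OF R.local] by blast
  thus ?thesis using R.completion_unit_iff[OF r(1)] unfolding r(2) by blast
qed

end

section \<open>The limit of the completions\<close>

theorem proposition4p2:
  fixes K :: "('a, 'm) ring_scheme"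
    and k V :: "'a set"
    and I :: "'i::preorder set"
    and i0 :: 'i
    and R :: "'i \<Rightarrow> 'a set"
  assumes "algebraic_function_field K k"
    and "valuation_ring_of K V"
    and "\<And>i j. i \<in> I \<Longrightarrow> j \<in> I \<Longrightarrow> \<exists>l \<in> I. i \<le> l \<and> j \<le> l"
    and "\<And>i j. i \<in> I \<Longrightarrow> j \<in> I \<Longrightarrow> i \<le> j \<Longrightarrow> R i \<subseteq> R j"
    and "\<And>i. i \<in> I \<Longrightarrow> local_subring K (R i)"
    and "\<And>i. i \<in> I \<Longrightarrow> integrally_closed_in K (R i)"
    and "V = (\<Union>i \<in> I. R i)"
    and "i0 \<in> I" and "\<And>i. i \<in> I \<Longrightarrow> i0 \<le> i"
    and "\<And>i. i \<in> I \<Longrightarrow> ess_finite_type K k (R i)"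
    and "\<And>i. i \<in> I \<Longrightarrow> quotient_field_is K (R i)"
    and "\<And>i j. i \<in> I \<Longrightarrow> j \<in> I \<Longrightarrow> i < j \<Longrightarrow> dominates K (R j) (R i)"
  shows "henselian (direct_limit I
           (\<lambda>i. completion (K\<lparr>carrier := R i\<rparr>))
           (\<lambda>i j. completion_map (K\<lparr>carrier := R j\<rparr>)))"
proof -
  let ?Q = "\<lambda>i. K\<lparr>carrier := R i\<rparr>"
  have local: "local_ring (?Q i)" if "i \<in> I" for i
    using assms(5)[OF that] unfolding local_subring_def by blast
  have local_cring: "local_cring (?Q i)" if "i \<in> I" for i
    using local[OF that]
    unfolding local_cring_def local_cring_axioms_def local_ring_def by blast
  have extension: "local_extension (?Q i) (?Q j)" if ij: "i \<in> I" "j \<in> I" "i \<le> j" for i j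
  proof (intro local_extension.intro local_extension_axioms.intro local_cring ij)
    show "(\<lambda>x. x) \<in> ring_hom (?Q i) (?Q j)"
      using assms(4)[OF ij] by (intro ring_hom_memI) auto
    show "max_ideal (?Q j) \<inter> carrier (?Q i) = max_ideal (?Q i)"
    \<comment> \<open>The indices are only preordered: \<open>i \<le> j\<close> without \<open>i < j\<close> gives equal rings.\<close>
    proof (cases "j \<le> i")
      case True
      hence "R i = R j" using assms(4) ij by blast
      moreover have "max_ideal (?Q i) \<subseteq> carrier (?Q i)"
        unfolding max_ideal_eq_nonunits[OF local[OF ij(1)]] by blast
      ultimately show ?thesis by auto
    next
      case False
      hence "i < j" using ij(3) by (simp add: less_le_not_le)
      thus ?thesis using assms(12)[OF ij(1,2)] unfolding dominates_def by simp
    qed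
  qed
  interpret directed_rings I "\<lambda>i. completion (?Q i)" "\<lambda>i j. completion_map (?Q j)"
  proof (rule directed_rings.intro)
    show "I \<noteq> {}" using assms(8) by blast
    show "\<exists>l \<in> I. i \<le> l \<and> j \<le> l" if "i \<in> I" "j \<in> I" for i j by (rule assms(3)[OF that])
    show "cring (completion (?Q i))" if "i \<in> I" for i
      by (rule local_cring.cring_completion[OF local_cring[OF that]])
    show "completion_map (?Q j) \<in> ring_hom (completion (?Q i)) (completion (?Q j))"
      if "i \<in> I" "j \<in> I" "i \<le> j" for i j
      by (rule local_extension.completion_map_hom[OF extension[OF that]])
  next
    fix i f assume i: "i \<in> I" and f: "f \<in> carrier (completion (?Q i))"
    interpret ii: local_extension "?Q i" "?Q i" by (rule extension[OF i i order_refl])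
    show "completion_map (?Q i) f = f"
      using f ii.completion_map_cosets unfolding ii.R.carrier_completion by force
  next
    fix i j l f assume ijl: "i \<in> I" "j \<in> I" "l \<in> I" "i \<le> j" "j \<le> l"
      and f: "f \<in> carrier (completion (?Q i))"
    interpret ij: local_extension "?Q i" "?Q j" by (rule extension[OF ijl(1,2,4)])
    interpret jl: local_extension "?Q j" "?Q l" by (rule extension[OF ijl(2,3,5)])
    interpret il: local_extension "?Q i" "?Q l"
      by (rule extension[OF ijl(1,3) order_trans[OF ijl(4,5)]])
    obtain r where r: "ij.R.coherent r" "f = ij.R.cosets r"
      using f unfolding ij.R.carrier_completion by blast
    show "completion_map (?Q l) (completion_map (?Q j) f) = completion_map (?Q l) f"
      unfolding r(2) ij.completion_map_cosets[OF r(1)] il.completion_map_cosets[OF r(1)]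
      by (rule jl.completion_map_cosets[OF ij.coherent_extension[OF r(1)]])
  qed
  show ?thesis
  proof (rule henselian_direct_limit)
    show "local_ring (completion (?Q i))" "simple_roots_lift (completion (?Q i))" if "i \<in> I" for i
      using local_cring.local_ring_completion[OF local_cring[OF that]]
        local_cring.simple_roots_lift_completion[OF local_cring[OF that]] by blast+
    show "f \<in> Units (completion (?Q i))"
      if "i \<in> I" "j \<in> I" "i \<le> j" "f \<in> carrier (completion (?Q i))"
        "completion_map (?Q j) f \<in> Units (completion (?Q j))" for i j f
      by (rule local_extension.completion_map_reflects_units[OF extension[OF that(1-3)] that(4,5)])
  qed
qed

end
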